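(* Consider the problem of minimizing $\phi(x_0,\dots,x_p,y)$ over $\mathbf{x}=(x_0,\dots,x_p)\in\mathbb{R}^n$, $y\in\mathbb{R}^q$ subject to $\mathbf{A}\mathbf{x}+By=0$, and suppose that all of the following hold. 1. (Coercivity) On $\mathcal{F}=\{(\mathbf{x},y)\in\mathbb{R}^{n+q}:\mathbf{A}\mathbf{x}+By=0\}$ the objective is coercive: $\phi(\mathbf{x},y)\to\infty$ if $(\mathbf{x},y)\in\mathcal{F}$ and $\|(\mathbf{x},y)\|\to\infty$. 2. (Feasibility) $\mathrm{Im}(\mathbf{A})\subseteq\mathrm{Im}(B)$. 3. (Lipschitz sub-minimization paths) (a) For any fixed $\mathbf{x}$, $\operatorname{argmin}_y\{\phi(\mathbf{x},y):By=u\}$ has a unique minimizer, and $H:\mathrm{Im}(B)\to\mathbb{R}^q$, $H(u)=\operatorname{argmin}_y\{\phi(\mathbf{x},y):By=u\}$, is Lipschitz continuous. (b) For $i=0,\dots,p$ and any $x_{<i},x_{>i},y$, $\operatorname{argmin}_{x_i}\{\phi(x_{<i},x_i,x_{>i},y):A_ix_i=u\}$ has a unique minimizer, and $F_i:\mathrm{Im}(A_i)\to\mathbb{R}^{n_i}$, $F_i(u)=\operatorname{argmin}_{x_i}\{\phi(x_{<i},x_i,x_{>i},y):A_ix_i=u\}$, is Lipschitz continuous. Moreover the maps $F_i$ and $H$ have a universal Lipschitz constant $\bar M>0$. 4. $\phi$ is Lipschitz differentiable with constant $L_\phi$. Then for any sufficiently large $\beta$, starting from any $x_1^0,\dots,x_p^0,y^0,w^0$,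 the ADMM algorithm (defined in the context) generates a sequence $(\mathbf{x}^k,y^k,w^k)$ that is bounded and has at least one limit point, and each limit point $(\mathbf{x}^*,y^*,w^* )$ is a stationary point of $\mathcal{L}_\beta$, namely $0\in\partial\mathcal{L}_\beta(\mathbf{x}^*,y^*,w^* )$. In addition, if $\mathcal{L}_\beta$ is a Kurdyka–Łojasiewicz function, then $(\mathbf{x}^k,y^k,w^k)$ converges (regardless of the initial point) to the unique limit point $(\mathbf{x}^*,y^*,w^* )$.
   Context: Setting: $p\ge 0$ is an integer, $x_i\in\mathbb{R}^{n_i}$ and $A_i\in\mathbb{R}^{m\times n_i}$ for $i=0,\dots,p$, $n=\sum_{i=0}^pn_i$, $y\in\mathbb{R}^q$, $B\in\mathbb{R}^{m\times q}$, $\mathbf{A}=[A_0\ \cdots\ A_p]$, $\mathbf{A}\mathbf{x}=\sum_{i=0}^pA_ix_i$. $\phi$ may be nonconvex and may couple $\mathbf{x}$ and $y$. Write $x_{<i}=(x_0,\dots,x_{i-1})$, $x_{>i}=(x_{i+1},\dots,x_p)$; $\mathrm{Im}(\cdot)$ is the image of a matrix and $\|\cdot\|$ the Euclidean norm. A function is Lipschitz differentiable (with constant $L$) if it is differentiable and its gradient is Lipschitz continuous (with constant $L$). Augmented Lagrangian ($\beta>0$, $w\in\mathbb{R}^m$): $\mathcal{L}_\beta(\mathbf{x},y,w)=\phi(\mathbf{x},y)+\langle w,\mathbf{A}\mathbf{x}+By\rangle+\frac{\beta}{2}\|\mathbf{A}\mathbf{x}+By\|^2$. ADMM algorithm: from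 $x_1^0,\dots,x_p^0,y^0,w^0$, for $k=0,1,2,\dots$: for $i=0,\dots,p$ in order, $x_i^{k+1}\in\operatorname{argmin}_{x_i}\mathcal{L}_\beta(x_{<i}^{k+1},x_i,x_{>i}^k,y^k,w^k)$; then $y^{k+1}\in\operatorname{argmin}_y\mathcal{L}_\beta(\mathbf{x}^{k+1},y,w^k)$; then $w^{k+1}=w^k+\beta(\mathbf{A}\mathbf{x}^{k+1}+By^{k+1})$. $\partial$ denotes the set of general (limiting) subgradients (Rockafellar–Wets, Variational Analysis, Def. 8.3). Kurdyka–Łojasiewicz (KŁ) function: a proper lower semicontinuous function $F$ such that for each $\bar u\in\mathrm{dom}(\partial F)$ there are $\eta\in(0,\infty]$, a neighborhood $U$ of $\bar u$, and a continuous concave $\varphi:[0,\eta)\to[0,\infty)$ with $\varphi(0)=0$, $\varphi$ being $C^1$ on $(0,\eta)$ with $\varphi'>0$, such that $\varphi'(F(u)-F(\bar u))\,\mathrm{dist}(0,\partial F(u))\ge1$ for all $u\in U$ with $F(\bar u)<F(u)<F(\bar u)+\eta$.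
   Formalization: In assumption 3, H and each F_i are required to be single maps of u, the same for all values of the other variables; sharing only the Lipschitz constant makes the claim false (p=0, A=0, B=1, φ=f(x)+xy with f strictly convex, x⁴ near 0, quadratic growth). *)

theory Defs
  imports "HOL-Analysis.Analysis"
begin

section \<open>Block coordinates\<close>

text \<open>
  The block sizes \<open>n\<^sub>0, \<dots>, n\<^sub>p\<close> depend on the block index, so the blocks are not given separate
  types: \<open>blk j\<close> is the block that coordinate \<open>j\<close> of \<open>x :: real ^ 'n\<close> belongs to, and the space
  of the \<open>i\<close>-th block is the set of vectors supported on the coordinates of block \<open>i\<close>.  The columns
  \<open>j\<close> of \<open>A\<close> with \<open>blk j = i\<close> form \<open>A\<^sub>i\<close>; for \<open>v \<in> block_space blk i\<close>, \<open>A *v v\<close> is \<open>A\<^sub>i v\<close>.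
\<close>

definition block_space :: "('n::finite \<Rightarrow> nat) \<Rightarrow> nat \<Rightarrow> (real ^ 'n) set" where
  "block_space blk i = {v. \<forall>j. blk j \<noteq> i \<longrightarrow> v $ j = 0}"

definition block_part :: "('n::finite \<Rightarrow> nat) \<Rightarrow> nat \<Rightarrow> real ^ 'n \<Rightarrow> real ^ 'n" where
  "block_part blk i x = (\<chi> j. if blk j = i then x $ j else 0)"

definition block_glue ::
    "('n::finite \<Rightarrow> nat) \<Rightarrow> nat \<Rightarrow> real ^ 'n \<Rightarrow> real ^ 'n \<Rightarrow> real ^ 'n \<Rightarrow> real ^ 'n" where
  \<comment> \<open>the point \<open>(a\<^sub>0, \<dots>, a\<^sub>i\<^sub>-\<^sub>1, v, b\<^sub>i\<^sub>+\<^sub>1, \<dots>, b\<^sub>p)\<close>\<close>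
  "block_glue blk i a v b =
     (\<chi> j. if blk j < i then a $ j else if blk j = i then v $ j else b $ j)"


section \<open>Assumptions on the objective\<close>

definition lipschitz_differentiable :: "real \<Rightarrow> ('a::real_inner \<Rightarrow> real) \<Rightarrow> bool" where
  "lipschitz_differentiable L f \<longleftrightarrow>
     (\<exists>g. (\<forall>x. GDERIV f x :> g x) \<and> L-lipschitz_on UNIV g)"

definition coercive_on :: "'a::real_normed_vector set \<Rightarrow> ('a \<Rightarrow> real) \<Rightarrow> bool" where
  "coercive_on S f \<longleftrightarrow> filterlim f at_top (inf at_infinity (principal S))"

definition is_unique_arg_min :: "('a \<Rightarrow> real) \<Rightarrow> ('a \<Rightarrow> bool) \<Rightarrow> 'a \<Rightarrow> bool" where
  "is_unique_arg_min f P x \<longleftrightarrow> is_arg_min f P x \<and> (\<forall>x'. is_arg_min f P x' \<longrightarrow> x' = x)"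

text \<open>
  The sub-minimization paths \<open>H : Im B \<rightarrow> \<real>\<^sup>q\<close> and \<open>F\<^sub>i\<close> on \<open>Im A\<^sub>i\<close> are functions of \<open>u\<close> alone: one
  function gives the minimizers for all values of the other variables.  It would not be enough
  to have a separate path for each value of the other variables and to share only the Lipschitz
  constant \<open>M\<close>.  For \<open>p = 0\<close>, \<open>A = 0\<close>, \<open>B = 1\<close>, \<open>\<phi>(x, y) = f x + x y\<close> on the real line, with \<open>f\<close>
  strictly convex, equal to \<open>x\<^sup>4\<close> near 0 and of quadratic growth, ADMM reduces near 0 to
  \<open>4 (x\<^sub>k\<^sub>+\<^sub>1)\<^sup>3 = (x\<^sub>k - x\<^sub>k\<^sub>-\<^sub>1) / \<beta>\<close>, whose nonzero trajectories do not tend to the only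
  stationary point 0, however large \<open>\<beta>\<close> is.
\<close>

definition lipschitz_path_y ::
    "((real ^ 'n) \<times> (real ^ 'q) \<Rightarrow> real) \<Rightarrow> real ^ 'q ^ 'm \<Rightarrow> real \<Rightarrow> (real ^ 'm \<Rightarrow> real ^ 'q) \<Rightarrow> bool" where
  "lipschitz_path_y \<phi> B M H \<longleftrightarrow>
     (\<forall>u \<in> range ((*v) B). \<forall>x. is_unique_arg_min (\<lambda>y. \<phi> (x, y)) (\<lambda>y. B *v y = u) (H u)) \<and>
     M-lipschitz_on (range ((*v) B)) H"

definition lipschitz_path_x ::
    "((real ^ 'n) \<times> (real ^ 'q) \<Rightarrow> real) \<Rightarrow> real ^ 'n ^ 'm \<Rightarrow> ('n \<Rightarrow> nat) \<Rightarrow> nat \<Rightarrow> real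
      \<Rightarrow> (real ^ 'm \<Rightarrow> real ^ 'n) \<Rightarrow> bool" where
  "lipschitz_path_x \<phi> A blk i M F \<longleftrightarrow>
     (\<forall>u \<in> (*v) A ` block_space blk i. \<forall>x y.
        is_unique_arg_min (\<lambda>v. \<phi> (block_glue blk i x v x, y))
          (\<lambda>v. v \<in> block_space blk i \<and> A *v v = u) (F u)) \<and>
     M-lipschitz_on ((*v) A ` block_space blk i) F"


section \<open>Augmented Lagrangian and ADMM\<close>

definition aug_lagrangian ::
    "((real ^ 'n) \<times> (real ^ 'q) \<Rightarrow> real) \<Rightarrow> real ^ 'n ^ 'm \<Rightarrow> real ^ 'q ^ 'm \<Rightarrow> real
      \<Rightarrow> (real ^ 'n) \<times> (real ^ 'q) \<times> (real ^ 'm) \<Rightarrow> real" where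
  "aug_lagrangian \<phi> A B \<beta> = (\<lambda>(x, y, w).
     \<phi> (x, y) + w \<bullet> (A *v x + B *v y) + \<beta> / 2 * (norm (A *v x + B *v y))\<^sup>2)"

text \<open>
  Block 0 of \<open>X 0\<close> does not influence the iteration: the update of block \<open>i\<close> uses the old
  values of the later blocks only.
\<close>

definition is_ADMM_sequence ::
    "((real ^ 'n) \<times> (real ^ 'q) \<Rightarrow> real) \<Rightarrow> real ^ 'n ^ 'm \<Rightarrow> real ^ 'q ^ 'm \<Rightarrow> ('n \<Rightarrow> nat) \<Rightarrow> nat \<Rightarrow> real
      \<Rightarrow> (nat \<Rightarrow> real ^ 'n) \<Rightarrow> (nat \<Rightarrow> real ^ 'q) \<Rightarrow> (nat \<Rightarrow> real ^ 'm) \<Rightarrow> bool" where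
  "is_ADMM_sequence \<phi> A B blk p \<beta> X Y W \<longleftrightarrow> (\<forall>k.
     (\<forall>i\<le>p. is_arg_min
        (\<lambda>v. aug_lagrangian \<phi> A B \<beta> (block_glue blk i (X (Suc k)) v (X k), Y k, W k))
        (\<lambda>v. v \<in> block_space blk i) (block_part blk i (X (Suc k)))) \<and>
     is_arg_min (\<lambda>y. aug_lagrangian \<phi> A B \<beta> (X (Suc k), y, W k)) (\<lambda>y. True) (Y (Suc k)) \<and>
     W (Suc k) = W k + \<beta> *\<^sub>R (A *v X (Suc k) + B *v Y (Suc k)))"

definition seq_limit_point :: "(nat \<Rightarrow> 'a::topological_space) \<Rightarrow> 'a \<Rightarrow> bool" where
  "seq_limit_point Z l \<longleftrightarrow> (\<exists>r :: nat \<Rightarrow> nat. strict_mono r \<and> (Z \<circ> r) \<longlonglongrightarrow> l)"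


section \<open>Limiting subgradients and the Kurdyka--Lojasiewicz property\<close>

text \<open>Regular and general (limiting) subgradients as in Rockafellar and Wets,
  Variational Analysis, Definition 8.3.\<close>

definition regular_subdiff :: "('a::euclidean_space \<Rightarrow> ereal) \<Rightarrow> 'a \<Rightarrow> 'a set" where
  "regular_subdiff f x = {v. \<bar>f x\<bar> \<noteq> \<infinity> \<and>
     0 \<le> Liminf (at x) (\<lambda>z. (f z - f x - ereal (v \<bullet> (z - x))) / ereal (norm (z - x)))}"

definition limiting_subdiff :: "('a::euclidean_space \<Rightarrow> ereal) \<Rightarrow> 'a \<Rightarrow> 'a set" where
  "limiting_subdiff f x = {v. \<bar>f x\<bar> \<noteq> \<infinity> \<and>
     (\<exists>z u. z \<longlonglongrightarrow> x \<and> (\<lambda>n. f (z n)) \<longlonglongrightarrow> f x \<and>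
        (\<forall>n::nat. u n \<in> regular_subdiff f (z n)) \<and> u \<longlonglongrightarrow> v)}"

definition proper_fun :: "('a \<Rightarrow> ereal) \<Rightarrow> bool" where
  "proper_fun f \<longleftrightarrow> (\<forall>x. f x \<noteq> -\<infinity>) \<and> (\<exists>x. f x \<noteq> \<infinity>)"

definition lsc_fun :: "('a::topological_space \<Rightarrow> ereal) \<Rightarrow> bool" where
  "lsc_fun f \<longleftrightarrow> (\<forall>x. f x \<le> Liminf (at x) f)"

text \<open>
  The distance from 0 to the subdifferential is an infimum in \<open>ereal\<close>, so that it is \<open>\<infinity>\<close> when the
  subdifferential is empty; \<open>infdist\<close> would give 0.
\<close>

definition KL_function :: "('a::euclidean_space \<Rightarrow> ereal) \<Rightarrow> bool" where
  "KL_function f \<longleftrightarrow> proper_fun f \<and> lsc_fun f \<and>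
     (\<forall>a. limiting_subdiff f a \<noteq> {} \<longrightarrow>
       (\<exists>(\<eta>::ereal) U \<psi> \<psi>'. 0 < \<eta> \<and> open U \<and> a \<in> U \<and>
          continuous_on {t. 0 \<le> t \<and> ereal t < \<eta>} \<psi> \<and>
          concave_on {t. 0 \<le> t \<and> ereal t < \<eta>} \<psi> \<and>
          (\<forall>t. 0 \<le> t \<and> ereal t < \<eta> \<longrightarrow> 0 \<le> \<psi> t) \<and> \<psi> 0 = 0 \<and>
          (\<forall>t. 0 < t \<and> ereal t < \<eta> \<longrightarrow> (\<psi> has_real_derivative \<psi>' t) (at t) \<and> 0 < \<psi>' t) \<and>
          continuous_on {t. 0 < t \<and> ereal t < \<eta>} \<psi>' \<and>
          (\<forall>u\<in>U. f a < f u \<and> f u < f a + \<eta> \<longrightarrow>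
             1 \<le> ereal (\<psi>' (real_of_ereal (f u - f a))) *
                  (INF v \<in> limiting_subdiff f u. ereal (dist 0 v)))))"

end

theory Submission
  imports Defs
begin

text \<open>
  The augmented Lagrangian serves as a Lyapunov function.  Every block update lowers it by a
  multiple, growing linearly with \<open>\<beta>\<close>, of the squared length of the block step
  (\<open>block_descent\<close>).  The Lipschitz paths make this possible without convexity: a minimizer lies
  on its path (\<open>admm_step_on_paths\<close>), so a block step \<open>d\<close> is bounded by its effect on the constraint,
  where the quadratic penalty acts, and the penalty outweighs the curvature of the objective.

  The multiplier update raises the Lagrangian.  Since \<open>y\<close> is updated last, its optimality condition
  ties the new multiplier to the gradient of the objective (\<open>multiplier_equation\<close>), and since
  \<open>Im A \<subseteq> Im B\<close> this determines the multiplier increment, which is thus bounded by the primal step,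
  uniformly in \<open>\<beta>\<close> (\<open>multiplier_step\<close>).  For large \<open>\<beta>\<close> the net effect of an iteration is a decrease
  by at least the squared primal step (\<open>sequence_decrease\<close>).

  Conversely, the Lagrangian at an iterate dominates the objective at a nearby feasible point
  (\<open>feasible_comparison\<close>), so coercivity on the constraint set bounds the sequence and hence
  the Lagrangian from below.  The steps tend to 0, and the gradient of the Lagrangian at an iterate is
  bounded by the last step (\<open>lag_grad_bound\<close>), so limit points are stationary.  Decrease by the
  squared step together with this gradient bound is also what the standard
  Kurdyka--Lojasiewicz argument turns into a finite total length
  (\<open>KL_convergence\<close>).

  Along a path the penalty makes the block subproblems coercive too, which gives the existence of
  the minimizers that the algorithm asks for (\<open>block_minimizer_exists\<close>).
\<close>

section \<open>Functions with Lipschitz gradient\<close>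

text \<open>
  Inserting \<open>t = - s / (\<bar>K\<bar> + 1)\<close> makes the linear term win.
\<close>

lemma zero_slope:
  fixes s K :: real
  assumes "\<And>t. 0 \<le> t * s + t\<^sup>2 * K"
  shows "s = 0"
proof -
  define C where "C = \<bar>K\<bar> + 1"
  have C: "K < C" "0 < C" by (auto simp: C_def)
  have "0 \<le> (- s / C) * s + (- s / C)\<^sup>2 * K" by (rule assms)
  also have "\<dots> = s\<^sup>2 * (K - C) / C\<^sup>2" using C by (simp add: field_simps power2_eq_square)
  finally have "0 \<le> s\<^sup>2 * (K - C)" using C by (simp add: zero_le_divide_iff)
  hence "s\<^sup>2 \<le> 0" using C by (simp add: zero_le_mult_iff)
  thus ?thesis by simp
qed

text \<open>
  Along the segment from \<open>x\<close> to \<open>y\<close>, the difference between \<open>f\<close> and the quadratic on the right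
  has nonpositive derivative, by Cauchy-Schwarz and the Lipschitz bound on \<open>g\<close>.
\<close>

lemma lipschitz_gradient_upper:
  fixes f :: "'a::euclidean_space \<Rightarrow> real"
  assumes grad: "\<And>z. GDERIV f z :> g z" and lip: "L-lipschitz_on UNIV g"
  shows "f y \<le> f x + g x \<bullet> (y - x) + L / 2 * (norm (y - x))\<^sup>2"
proof -
  define h where
    "h t = f (x + t *\<^sub>R (y - x)) - t * (g x \<bullet> (y - x)) - L / 2 * t\<^sup>2 * (norm (y - x))\<^sup>2" for t
  define h' where
    "h' t = (y - x) \<bullet> g (x + t *\<^sub>R (y - x)) - g x \<bullet> (y - x) - L * t * (norm (y - x))\<^sup>2" for t
  have der: "(h has_real_derivative h' t) (at t)" for t
  proof -
    have "((\<lambda>t. f (x + t *\<^sub>R (y - x))) has_derivative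
        (\<lambda>s. (s *\<^sub>R (y - x)) \<bullet> g (x + t *\<^sub>R (y - x)))) (at t)"
      by (rule has_derivative_compose[OF _ grad[unfolded gderiv_def]])
         (auto intro!: derivative_eq_intros)
    hence "((\<lambda>t. f (x + t *\<^sub>R (y - x))) has_real_derivative
        (y - x) \<bullet> g (x + t *\<^sub>R (y - x))) (at t)"
      unfolding has_field_derivative_def
      by (rule has_derivative_eq_rhs) (auto simp: fun_eq_iff mult.commute)
    thus ?thesis unfolding h_def h'_def
      by (auto intro!: derivative_eq_intros)
  qed
  have "h' t \<le> 0" if "0 \<le> t" for t
  proof -
    have "(y - x) \<bullet> (g (x + t *\<^sub>R (y - x)) - g x) \<le> norm (y - x) * norm (g (x + t *\<^sub>R (y - x)) - g x)"
      by (rule norm_cauchy_schwarz)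
    also have "\<dots> \<le> norm (y - x) * (L * norm (t *\<^sub>R (y - x)))"
      using lipschitz_onD[OF lip, of "x + t *\<^sub>R (y - x)" x]
      by (intro mult_left_mono) (auto simp: dist_norm)
    also have "\<dots> = L * t * (norm (y - x))\<^sup>2"
      using that by (simp add: power2_eq_square)
    finally show ?thesis
      unfolding h'_def by (simp add: inner_diff_right inner_commute)
  qed
  hence "h 1 \<le> h 0"
    by (intro DERIV_nonpos_imp_nonincreasing[of 0 1 h]) (use der in auto)
  thus ?thesis unfolding h_def by simp
qed

lemma lipschitz_gradient_lower:
  fixes f :: "'a::euclidean_space \<Rightarrow> real"
  assumes grad: "\<And>z. GDERIV f z :> g z" and lip: "L-lipschitz_on UNIV g"
  shows "f y \<ge> f x + g x \<bullet> (y - x) - L / 2 * (norm (y - x))\<^sup>2"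
  using lipschitz_gradient_upper[of "\<lambda>z. - f z" "\<lambda>z. - g z" L y x]
    GDERIV_minus[OF grad] lip by simp

section \<open>Descent sequences and the Kurdyka--Lojasiewicz inequality\<close>

text \<open>
  Differentiability makes the difference quotient in the definition of a regular subgradient tend
  to 0, and constant sequences turn regular subgradients into limiting ones.  The inclusion serves
  twice: it gives stationarity at points with zero gradient, and it bounds the distance from 0
  to the subdifferential by the norm of the gradient in the Kurdyka--Lojasiewicz inequality.
\<close>

lemma gradient_in_limiting_subdiff:
  fixes f :: "'a::euclidean_space \<Rightarrow> real"
  assumes "GDERIV f x :> v"
  shows "v \<in> limiting_subdiff (\<lambda>z. ereal (f z)) x"
proof -
  have "((\<lambda>z. (f z - f x - (z - x) \<bullet> v) / norm (z - x)) \<longlongrightarrow> 0) (at x)"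
    using assms unfolding gderiv_def has_derivative_at_within
    by (simp add: divide_inverse mult.commute)
  hence "((\<lambda>z. ereal ((f z - f x - v \<bullet> (z - x)) / norm (z - x))) \<longlongrightarrow> ereal 0) (at x)"
    by (intro tendsto_ereal) (simp add: inner_commute)
  moreover have "eventually (\<lambda>z. ereal ((f z - f x - v \<bullet> (z - x)) / norm (z - x)) =
      (ereal (f z) - ereal (f x) - ereal (v \<bullet> (z - x))) / ereal (norm (z - x))) (at x)"
    by (auto simp: eventually_at_filter)
  ultimately have "((\<lambda>z. (ereal (f z) - ereal (f x) - ereal (v \<bullet> (z - x))) / ereal (norm (z - x)))
      \<longlongrightarrow> ereal 0) (at x)"
    by (rule Lim_transform_eventually)
  hence "Liminf (at x) (\<lambda>z. (ereal (f z) - ereal (f x) - ereal (v \<bullet> (z - x))) / ereal (norm (z - x))) = 0"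
    using lim_imp_Liminf[OF trivial_limit_at[of x]] by (simp add: zero_ereal_def)
  hence "v \<in> regular_subdiff (\<lambda>z. ereal (f z)) x"
    unfolding regular_subdiff_def by simp
  thus ?thesis
    unfolding limiting_subdiff_def
    by (intro CollectI conjI exI[of _ "\<lambda>_. x"] exI[of _ "\<lambda>_. v"]) auto
qed

text \<open>
  The values decrease, and along a convergent subsequence they tend to \<open>f l\<close> by continuity, so the
  whole sequence of values does.  The decrease per step then vanishes, and it dominates the squared
  step length.
\<close>

lemma descent_limit_point:
  fixes f :: "'a::euclidean_space \<Rightarrow> real"
  assumes grad: "\<And>z. GDERIV f z :> g z"
    and a: "a > 0" and decrease: "\<And>k. f (Z (Suc k)) + a * (norm (Z (Suc k) - Z k))\<^sup>2 \<le> f (Z k)"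
    and limit: "seq_limit_point Z l"
  shows "decseq (\<lambda>k. f (Z k))" "(\<lambda>k. f (Z k)) \<longlonglongrightarrow> f l" "\<And>k. f l \<le> f (Z k)"
    "(\<lambda>k. norm (Z (Suc k) - Z k)) \<longlonglongrightarrow> 0"
proof -
  obtain r where r: "strict_mono r" and lim: "(Z \<circ> r) \<longlonglongrightarrow> l"
    using limit unfolding seq_limit_point_def by blast
  have cont: "isCont f z" for z
    using grad[of z] unfolding gderiv_def by (rule has_derivative_continuous)
  have dec: "decseq (\<lambda>k. f (Z k))"
  proof (rule decseq_SucI)
    fix k have "0 \<le> a * (norm (Z (Suc k) - Z k))\<^sup>2" using a by simp
    thus "f (Z (Suc k)) \<le> f (Z k)" using decrease[of k] by linarith
  qed
  have fr: "(\<lambda>n. f (Z (r n))) \<longlonglongrightarrow> f l"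
    using isCont_tendsto_compose[OF cont lim] by (simp add: o_def)
  have decr: "decseq (\<lambda>n. f (Z (r n)))"
    using dec strict_mono_mono[OF r] by (auto simp: decseq_def mono_def)
  show ge: "f l \<le> f (Z k)" for k
  proof -
    have "f l \<le> f (Z (r k))" using decseq_ge[OF decr fr] by simp
    also have "\<dots> \<le> f (Z k)" using dec seq_suble[OF r] by (auto simp: decseq_def)
    finally show ?thesis .
  qed
  show conv: "(\<lambda>k. f (Z k)) \<longlonglongrightarrow> f l"
  proof (rule LIMSEQ_I)
    fix e :: real assume "0 < e"
    then obtain n where n: "norm (f (Z (r n)) - f l) < e"
      using LIMSEQ_D[OF fr] by blast
    have "norm (f (Z k) - f l) < e" if "k \<ge> r n" for k
    proof -
      have "f (Z k) \<le> f (Z (r n))" using decseqD[OF dec that] .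
      thus ?thesis using n ge[of k] by (simp add: abs_if split: if_splits)
    qed
    thus "\<exists>no. \<forall>k\<ge>no. norm (f (Z k) - f l) < e" by blast
  qed
  have "(\<lambda>k. (f (Z k) - f (Z (Suc k))) / a) \<longlonglongrightarrow> 0"
    using tendsto_divide[OF tendsto_diff[OF conv LIMSEQ_Suc[OF conv]] tendsto_const[of a]] a by simp
  hence "(\<lambda>k. (norm (Z (Suc k) - Z k))\<^sup>2) \<longlonglongrightarrow> 0"
  proof (rule tendsto_sandwich[OF _ _ tendsto_const, rotated 2])
    show "\<forall>\<^sub>F k in sequentially. (norm (Z (Suc k) - Z k))\<^sup>2 \<le> (f (Z k) - f (Z (Suc k))) / a"
      using decrease a by (auto simp: field_simps intro!: always_eventually)
  qed auto
  thus "(\<lambda>k. norm (Z (Suc k) - Z k)) \<longlonglongrightarrow> 0" by simp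
  show "decseq (\<lambda>k. f (Z k))" by (rule dec)
qed

lemma descent_limit_point_critical:
  fixes f :: "'a::euclidean_space \<Rightarrow> real"
  assumes grad: "\<And>z. GDERIV f z :> g z" and cont: "continuous_on UNIV g"
    and a: "a > 0" and decrease: "\<And>k. f (Z (Suc k)) + a * (norm (Z (Suc k) - Z k))\<^sup>2 \<le> f (Z k)"
    and slope: "\<And>k. norm (g (Z (Suc k))) \<le> b * norm (Z (Suc k) - Z k)"
    and limit: "seq_limit_point Z l"
  shows "g l = 0"
proof -
  obtain r where r: "strict_mono r" and lim: "(Z \<circ> r) \<longlonglongrightarrow> l"
    using limit unfolding seq_limit_point_def by blast
  have "(\<lambda>k. b * norm (Z (Suc k) - Z k)) \<longlonglongrightarrow> b * 0"
    by (intro tendsto_mult_left descent_limit_point(4)[OF grad a decrease limit])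
  hence "(\<lambda>k. b * norm (Z (Suc k) - Z k)) \<longlonglongrightarrow> 0" by simp
  hence "(\<lambda>k. g (Z (Suc k))) \<longlonglongrightarrow> 0"
    by (rule Lim_null_comparison[rotated]) (intro always_eventually allI slope)
  hence "(\<lambda>k. g (Z k)) \<longlonglongrightarrow> 0" by (rule LIMSEQ_imp_Suc)
  hence "((\<lambda>k. g (Z k)) \<circ> r) \<longlonglongrightarrow> 0" using r by (rule LIMSEQ_subseq_LIMSEQ)
  moreover have "(\<lambda>n. g ((Z \<circ> r) n)) \<longlonglongrightarrow> g l"
    using continuous_on_tendsto_compose[OF cont lim] by simp
  ultimately show ?thesis
    by (intro LIMSEQ_unique[of "\<lambda>n. g (Z (r n))"]) (simp_all add: o_def)
qed

text \<open>
  The classical finite-length argument.  Near \<open>l\<close>, concavity of the desingularizing function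
  \<open>\<psi>\<close> and the Kurdyka--Lojasiewicz inequality turn the decrease of \<open>f\<close> into a decrease of
  \<open>\<psi> (f (Z k) - f l)\<close> that bounds the step lengths \<open>d k\<close> linearly:
  \<open>2 * d (k + 1) \<le> d k + b / a * (\<psi> (f (Z (k + 1)) - f l) - \<psi> (f (Z (k + 2)) - f l))\<close>.
  This telescopes.  Started at an iterate that is close enough to \<open>l\<close>, the sum of the remaining
  steps is so small that the sequence never leaves the neighbourhood in which the inequality holds;
  the steps are therefore summable and the sequence is Cauchy.
\<close>

lemma KL_convergence:
  fixes f :: "'a::euclidean_space \<Rightarrow> real"
  assumes grad: "\<And>z. GDERIV f z :> g z"
    and KL: "KL_function (\<lambda>z. ereal (f z))"
    and a: "a > 0" and decrease: "\<And>k. f (Z (Suc k)) + a * (norm (Z (Suc k) - Z k))\<^sup>2 \<le> f (Z k)"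
    and b: "b > 0" and slope: "\<And>k. norm (g (Z (Suc k))) \<le> b * norm (Z (Suc k) - Z k)"
    and limit: "seq_limit_point Z l"
  shows "Z \<longlonglongrightarrow> l"
proof -
  obtain r where r: "strict_mono r" and lim: "(Z \<circ> r) \<longlonglongrightarrow> l"
    using limit unfolding seq_limit_point_def by blast
  note dec = descent_limit_point(1)[OF grad a decrease limit]
    and conv = descent_limit_point(2)[OF grad a decrease limit]
    and ge = descent_limit_point(3)[OF grad a decrease limit]
  show ?thesis
  proof (cases "\<exists>m. f (Z m) = f l")
    case True
    then obtain m where m: "f (Z m) = f l" by blast
    \<comment> \<open>Once the limit value is attained there is no decrease left, so the sequence stops moving.\<close>
    have const: "Z k = Z m" if "k \<ge> m" for k
      using that
    proof (induction k rule: dec_induct)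
      case (step k)
      have "f (Z (Suc k)) + a * (norm (Z (Suc k) - Z k))\<^sup>2 \<le> f (Z k)" by (rule decrease)
      also have "f (Z k) \<le> f (Z m)" using dec step by (auto simp: decseq_def)
      finally have "a * (norm (Z (Suc k) - Z k))\<^sup>2 \<le> 0" using ge[of "Suc k"] m by linarith
      hence "Z (Suc k) = Z k" using a by (simp add: mult_le_0_iff)
      thus ?case using step by simp
    qed simp
    have Zm: "Z \<longlonglongrightarrow> Z m"
      by (rule tendsto_eventually) (use const in \<open>unfold eventually_sequentially, blast\<close>)
    moreover have "Z m = l"
      by (rule LIMSEQ_unique[OF LIMSEQ_subseq_LIMSEQ[OF Zm r] lim])
    ultimately show ?thesis by simp
  next
    case False
    hence gt: "f l < f (Z k)" for k using ge[of k] by (metis order_le_less)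
    have "limiting_subdiff (\<lambda>z. ereal (f z)) l \<noteq> {}"
      using gradient_in_limiting_subdiff[OF grad] by blast
    then obtain \<eta> :: ereal and U \<psi> \<psi>' where eta: "0 < \<eta>" and U: "open U" "l \<in> U"
      and psi_cont: "continuous_on {t. 0 \<le> t \<and> ereal t < \<eta>} \<psi>"
      and psi_conc: "concave_on {t. 0 \<le> t \<and> ereal t < \<eta>} \<psi>"
      and psi_nn: "\<And>t. 0 \<le> t \<Longrightarrow> ereal t < \<eta> \<Longrightarrow> 0 \<le> \<psi> t" and psi0: "\<psi> 0 = 0"
      and psi_der: "\<And>t. 0 < t \<Longrightarrow> ereal t < \<eta> \<Longrightarrow> (\<psi> has_real_derivative \<psi>' t) (at t) \<and> 0 < \<psi>' t"
      and ineq: "\<And>u. u \<in> U \<Longrightarrow> ereal (f l) < ereal (f u) \<Longrightarrow> ereal (f u) < ereal (f l) + \<eta> \<Longrightarrow>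
             1 \<le> ereal (\<psi>' (real_of_ereal (ereal (f u) - ereal (f l)))) *
                  (INF v \<in> limiting_subdiff (\<lambda>z. ereal (f z)) u. ereal (dist 0 v))"
      using KL unfolding KL_function_def by (elim conjE allE[of _ l] impE) (assumption, blast)
    define D where "D = {t. 0 \<le> t \<and> ereal t < \<eta>}"
    define h where "h k = f (Z k) - f l" for k
    have h_pos: "0 < h k" for k using gt by (simp add: h_def)
    have h0: "h \<longlonglongrightarrow> 0" unfolding h_def using tendsto_diff[OF conv tendsto_const[of "f l"]] by simp
    have h_dom: "eventually (\<lambda>k. ereal (h k) < \<eta>) sequentially"
    proof -
      have "(\<lambda>k. ereal (h k)) \<longlonglongrightarrow> ereal 0" using h0 by (rule tendsto_ereal)
      thus ?thesis using eta by (intro order_tendstoD(2)[of _ "ereal 0"]) (auto simp: zero_ereal_def)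
    qed
    have slope_psi: "1 \<le> \<psi>' (h k) * norm (g (Z k))" if "Z k \<in> U" "ereal (h k) < \<eta>" for k
    proof -
      have "ereal (f (Z k)) < ereal (f l) + \<eta>"
        using that(2) unfolding h_def by (cases \<eta>) (auto simp: algebra_simps)
      hence "1 \<le> ereal (\<psi>' (h k)) * (INF v \<in> limiting_subdiff (\<lambda>z. ereal (f z)) (Z k). ereal (dist 0 v))"
        using ineq[OF that(1)] gt[of k] by (simp add: h_def)
      also have "\<dots> \<le> ereal (\<psi>' (h k)) * ereal (dist 0 (g (Z k)))"
        using psi_der[OF h_pos that(2)]
        by (intro ereal_mult_left_mono INF_lower gradient_in_limiting_subdiff grad) auto
      finally show ?thesis by simp
    qed
    \<comment> \<open>Concavity of \<open>\<psi>\<close>, with 0 allowed as the left point although \<open>\<psi>\<close> need not be differentiable there.\<close>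
    have tangent: "\<psi>' t * (t - s) \<le> \<psi> t - \<psi> s" if "0 < t" "ereal t < \<eta>" "0 \<le> s" "s \<le> t" for s t
    proof -
      have "open ({0<..} \<inter> ereal -` {..<\<eta>})"
        by (intro open_Int open_vimage) (auto intro: continuous_on_ereal continuous_intros)
      hence "t \<in> interior D"
        using that by (intro interiorI[of "{0<..} \<inter> ereal -` {..<\<eta>}"]) (auto simp: D_def)
      moreover have "convex_on D (\<lambda>x. - \<psi> x)" using psi_conc unfolding concave_on_def D_def .
      moreover have "connected D"
        using psi_conc unfolding concave_on_def D_def convex_on_def by (blast intro: convex_connected)
      moreover have "s \<in> D" unfolding D_def using that le_less_trans[of "ereal s" "ereal t" \<eta>] by auto
      moreover have "((\<lambda>x. - \<psi> x) has_real_derivative - \<psi>' t) (at t within D)"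
        using psi_der[OF that(1,2)] by (auto intro: DERIV_minus has_field_derivative_at_within)
      ultimately have "- \<psi>' t * (s - t) \<le> (- \<psi> s) - (- \<psi> t)"
        by (intro convex_on_imp_above_tangent[of D]) auto
      thus ?thesis by (simp add: algebra_simps)
    qed
    define d where "d k = norm (Z (Suc k) - Z k)" for k
    have d0: "d \<longlonglongrightarrow> 0" unfolding d_def by (rule descent_limit_point(4)[OF grad a decrease limit])
    have step: "2 * d (Suc k) \<le> d k + b / a * (\<psi> (h (Suc k)) - \<psi> (h (Suc (Suc k))))"
      if inU: "Z (Suc k) \<in> U" and dom: "ereal (h (Suc k)) < \<eta>" for k
    proof -
      let ?p = "\<psi>' (h (Suc k))" and ?q = "b / a * (\<psi> (h (Suc k)) - \<psi> (h (Suc (Suc k))))"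
      have p: "0 < ?p" using psi_der[OF h_pos dom] by simp
      have "1 \<le> ?p * (b * d k)"
        using slope_psi[OF inU dom] mult_left_mono[OF slope[of k] less_imp_le[OF p]]
        by (simp add: d_def)
      moreover have "0 \<le> d k" "0 \<le> d (Suc k)" by (auto simp: d_def)
      moreover have "h (Suc (Suc k)) \<le> h (Suc k)" using dec by (simp add: h_def decseq_Suc_iff)
      hence "?p * (h (Suc k) - h (Suc (Suc k))) \<le> \<psi> (h (Suc k)) - \<psi> (h (Suc (Suc k)))"
        using dom by (intro tangent) (auto intro: h_pos less_imp_le)
      moreover have "?p * (a * (d (Suc k))\<^sup>2) \<le> ?p * (h (Suc k) - h (Suc (Suc k)))"
        using decrease[of "Suc k"] p by (intro mult_left_mono) (auto simp: h_def d_def)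
      ultimately have "?p * (a * (d (Suc k))\<^sup>2) \<le> \<psi> (h (Suc k)) - \<psi> (h (Suc (Suc k)))" by linarith
      hence "b / a * (?p * (a * (d (Suc k))\<^sup>2)) \<le> ?q"
        using a b by (intro mult_left_mono) auto
      hence q: "?p * b * (d (Suc k))\<^sup>2 \<le> ?q" using a by (simp add: field_simps)
      have "(d (Suc k))\<^sup>2 * 1 \<le> (d (Suc k))\<^sup>2 * (?p * (b * d k))"
        using \<open>1 \<le> ?p * (b * d k)\<close> by (intro mult_left_mono) auto
      also have "\<dots> = d k * (?p * b * (d (Suc k))\<^sup>2)" by (simp add: algebra_simps)
      also have "\<dots> \<le> d k * ?q" using q \<open>0 \<le> d k\<close> by (rule mult_left_mono)
      finally have "(d (Suc k))\<^sup>2 \<le> d k * ?q" by simp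
      moreover have "4 * (s * t) \<le> (s + t)\<^sup>2" for s t :: real
        using sum_squares_bound[of s t] by (simp add: power2_sum)
      from this[of "d k" ?q] have "4 * (d k * ?q) \<le> (d k + ?q)\<^sup>2" .
      \<comment> \<open>The square of the claimed recursion, from the inequality between geometric and arithmetic mean.\<close>
      ultimately have "(2 * d (Suc k))\<^sup>2 \<le> (d k + ?q)\<^sup>2" by (simp add: power_mult_distrib)
      moreover have "0 \<le> ?p * b * (d (Suc k))\<^sup>2" using p b by simp
      hence "0 \<le> ?q" using q by linarith
      ultimately show ?thesis
        using \<open>0 \<le> d k\<close> by (intro power2_le_imp_le[of "2 * d (Suc k)"]) auto
    qed
    have psi_h: "(\<lambda>k. \<psi> (h k)) \<longlonglongrightarrow> 0"
    proof -
      have "(\<psi> \<longlongrightarrow> \<psi> 0) (at 0 within D)"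
        using psi_cont eta unfolding continuous_on_def D_def by (auto simp: zero_ereal_def)
      moreover have "filterlim h (at 0 within D) sequentially"
        unfolding filterlim_at using h0 h_dom h_pos
        by (auto simp: D_def less_imp_le less_imp_neq[symmetric] elim!: eventually_mono)
      ultimately show ?thesis using psi0 by (metis filterlim_compose)
    qed
    obtain \<rho> where rho: "0 < \<rho>" "ball l \<rho> \<subseteq> U" using U open_contains_ball by blast
    have "\<exists>N. Z (Suc N) \<in> ball l (\<rho>/3) \<and> d N < \<rho>/3 \<and> b / a * \<psi> (h (Suc N)) < \<rho>/3 \<and>
        (\<forall>k\<ge>N. ereal (h k) < \<eta>)"
    proof -
      have "(\<lambda>k. b / a * \<psi> (h (Suc k))) \<longlonglongrightarrow> b / a * 0"
        by (intro tendsto_intros LIMSEQ_Suc psi_h)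
      hence "eventually (\<lambda>N. b / a * \<psi> (h (Suc N)) < \<rho>/3) sequentially"
        using rho by (intro order_tendstoD(2)) auto
      moreover have "eventually (\<lambda>N. d N < \<rho>/3) sequentially"
        using d0 rho by (intro order_tendstoD(2)) auto
      moreover have "eventually (\<lambda>N. \<forall>k\<ge>N. ereal (h k) < \<eta>) sequentially"
        using h_dom by (rule eventually_all_ge_at_top)
      ultimately have "eventually (\<lambda>N. d N < \<rho>/3 \<and> b / a * \<psi> (h (Suc N)) < \<rho>/3 \<and>
        (\<forall>k\<ge>N. ereal (h k) < \<eta>)) sequentially"
        by (intro eventually_conj)
      then obtain N0 where N0: "\<And>N. N \<ge> N0 \<Longrightarrow> d N < \<rho>/3 \<and> b / a * \<psi> (h (Suc N)) < \<rho>/3 \<and>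
        (\<forall>k\<ge>N. ereal (h k) < \<eta>)"
        unfolding eventually_sequentially by blast
      have "eventually (\<lambda>n. Z (r n) \<in> ball l (\<rho>/3)) sequentially"
        using tendstoD[OF lim, of "\<rho>/3"] rho by (simp add: o_def dist_commute)
      moreover have "eventually (\<lambda>n. Suc N0 \<le> r n) sequentially"
        using filterlim_subseq[OF r] by (simp add: filterlim_at_top)
      ultimately have "eventually (\<lambda>n. Z (r n) \<in> ball l (\<rho>/3) \<and> Suc N0 \<le> r n) sequentially"
        by (rule eventually_conj)
      then obtain n where n: "Z (r n) \<in> ball l (\<rho>/3)" "Suc N0 \<le> r n"
        using eventually_happens'[OF sequentially_bot] by blast
      then obtain N where "r n = Suc N" "N0 \<le> N" by (cases "r n") auto
      thus ?thesis using n N0 by auto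
    qed
    then obtain N where N: "Z (Suc N) \<in> ball l (\<rho>/3)" "d N < \<rho>/3" "b / a * \<psi> (h (Suc N)) < \<rho>/3"
      "\<And>k. k \<ge> N \<Longrightarrow> ereal (h k) < \<eta>" by blast
    \<comment> \<open>Carrying the last step length \<open>d (N + m)\<close> on the left absorbs the \<open>d k\<close> in the recursion
      and makes the induction close.\<close>
    have track: "(\<Sum>k<m. d (Suc N + k)) + d (N + m) \<le> d N + b / a * (\<psi> (h (Suc N)) - \<psi> (h (Suc N + m)))
       \<and> Z (Suc N + m) \<in> ball l \<rho>" for m
    proof (induction m)
      case 0
      show ?case using N(1) rho by auto
    next
      case (Suc m)
      have "2 * d (Suc (N + m)) \<le> d (N + m) +
          b / a * (\<psi> (h (Suc (N + m))) - \<psi> (h (Suc (Suc (N + m)))))"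
        using Suc rho(2) N(4)[of "Suc (N + m)"] by (intro step) auto
      hence 1: "(\<Sum>k<Suc m. d (Suc N + k)) + d (N + Suc m) \<le>
          d N + b / a * (\<psi> (h (Suc N)) - \<psi> (h (Suc N + Suc m)))"
        using Suc by (simp add: algebra_simps)
      have "Z (Suc N + Suc m) - Z (Suc N) = (\<Sum>k<Suc m. Z (Suc N + Suc k) - Z (Suc N + k))"
        by (subst sum_lessThan_telescope) simp
      hence "dist (Z (Suc N)) (Z (Suc N + Suc m)) \<le> (\<Sum>k<Suc m. d (Suc N + k))"
        unfolding dist_norm d_def by (subst norm_minus_commute) (simp only: norm_sum add_Suc_right)
      also have "\<dots> \<le> d N + b / a * \<psi> (h (Suc N)) - b / a * \<psi> (h (Suc N + Suc m))"
      proof -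
        have "0 \<le> d (N + Suc m)" by (simp add: d_def)
        thus ?thesis using 1 by (simp add: right_diff_distrib)
      qed
      also have "\<dots> \<le> d N + b / a * \<psi> (h (Suc N))"
        using psi_nn[OF less_imp_le[OF h_pos] N(4)[of "Suc N + Suc m"]] a b by simp
      finally have "dist (Z (Suc N)) (Z (Suc N + Suc m)) < 2 * \<rho> / 3" using N by linarith
      moreover have "dist l (Z (Suc N)) < \<rho> / 3" using N(1) by simp
      ultimately have "dist l (Z (Suc N + Suc m)) < \<rho>"
        using dist_triangle[of l "Z (Suc N + Suc m)" "Z (Suc N)"] by linarith
      thus ?case using 1 by simp
    qed
    have "summable (\<lambda>k. d (Suc N + k))"
    proof (rule summableI_nonneg_bounded)
      fix m
      show "(\<Sum>k<m. d (Suc N + k)) \<le> d N + b / a * \<psi> (h (Suc N))"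
      proof -
        have "0 \<le> b / a * \<psi> (h (Suc N + m))"
          using psi_nn[OF less_imp_le[OF h_pos] N(4)[of "Suc N + m"]] a b by simp
        moreover have "0 \<le> d (N + m)" by (simp add: d_def)
        ultimately show ?thesis using track[of m] by (simp add: right_diff_distrib)
      qed
    qed (simp add: d_def)
    hence "summable (\<lambda>k. Z (Suc (Suc N + k)) - Z (Suc N + k))"
      unfolding d_def by (rule summable_norm_cancel)
    hence "convergent (\<lambda>m. \<Sum>k<m. Z (Suc (Suc N + k)) - Z (Suc N + k))"
      by (simp add: summable_iff_convergent)
    moreover have "(\<Sum>k<m. Z (Suc (Suc N + k)) - Z (Suc N + k)) = Z (Suc N + m) - Z (Suc N)" for m
      using sum_lessThan_telescope[of "\<lambda>k. Z (Suc N + k)" m] by simp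
    ultimately have "convergent (\<lambda>m. Z (m + Suc N))"
      using convergent_diff_const_right_iff[of "\<lambda>m. Z (Suc N + m)" "Z (Suc N)"]
      by (simp add: add.commute)
    then obtain l' where "(\<lambda>m. Z (m + Suc N)) \<longlonglongrightarrow> l'"
      by (auto simp: convergent_def)
    hence l': "Z \<longlonglongrightarrow> l'" by (rule LIMSEQ_offset)
    moreover have "l' = l"
      by (rule LIMSEQ_unique[OF LIMSEQ_subseq_LIMSEQ[OF l' r] lim])
    ultimately show ?thesis by simp
  qed
qed

section \<open>Minimization over blocks under a linear constraint\<close>

text \<open>
  The variable \<open>z\<close> stands for the pair \<open>(\<^bold>x, y)\<close>.  The projections \<open>P 0, \<dots>, P N\<close> split it into blocks,
  block \<open>N\<close> being \<open>y\<close>; all blocks are updated in the same way, so one treatment covers the updates of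
  the \<open>x\<^sub>i\<close> and of \<open>y\<close>.  The special role of the last block lies only in \<open>feasible\<close>, and in
  the multiplier update that follows it.  The constraint is \<open>T z = 0\<close>, and \<open>G i\<close> is the
  sub-minimization path of block \<open>i\<close>.
\<close>

locale block_problem =
  fixes f :: "'a::euclidean_space \<Rightarrow> real" and g :: "'a \<Rightarrow> 'a" and L :: real
    and T :: "'a \<Rightarrow> 'b::euclidean_space"
    and P :: "nat \<Rightarrow> 'a \<Rightarrow> 'a" and N :: nat
    and G :: "nat \<Rightarrow> 'b \<Rightarrow> 'a" and M :: real
  assumes grad: "\<And>z. GDERIV f z :> g z" and lip: "L-lipschitz_on UNIV g"
    and linear_T: "linear T" and linear_P: "\<And>i. linear (P i)"
    and P_P: "\<And>i j z. P i (P j z) = (if i = j then P i z else 0)"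
    and P_sum: "\<And>z. (\<Sum>i\<le>N. P i z) = z"
    and P_norm: "\<And>i z. norm (P i z) \<le> norm z"
    and M_pos: "0 < M"
    and path_in: "\<And>i u. i \<le> N \<Longrightarrow> u \<in> T ` range (P i) \<Longrightarrow> G i u \<in> range (P i) \<and> T (G i u) = u"
    and path_min: "\<And>i v c. i \<le> N \<Longrightarrow> v \<in> range (P i) \<Longrightarrow> P i c = 0 \<Longrightarrow> f (c + G i (T v)) \<le> f (c + v)"
    and path_unique: "\<And>i v c. i \<le> N \<Longrightarrow> v \<in> range (P i) \<Longrightarrow> P i c = 0 \<Longrightarrow>
      f (c + v) \<le> f (c + G i (T v)) \<Longrightarrow> v = G i (T v)"
    and path_lip: "\<And>i. i \<le> N \<Longrightarrow> M-lipschitz_on (T ` range (P i)) (G i)"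
    and feasible: "range T \<subseteq> T ` range (P N)"
    and coercive: "coercive_on {z. T z = 0} f"
begin

lemmas T_simps = linear_add[OF linear_T] linear_diff[OF linear_T] linear_cmul[OF linear_T]
  linear_neg[OF linear_T] linear_0[OF linear_T]

lemmas P_simps = linear_add[OF linear_P] linear_diff[OF linear_P] linear_cmul[OF linear_P]
  linear_neg[OF linear_P] linear_0[OF linear_P]

lemma L_nonneg: "0 \<le> L"
  using lip by (rule lipschitz_on_nonneg)

lemma P_of_range: "v \<in> range (P i) \<Longrightarrow> P i v = v"
  using P_P by auto

lemma subspace_block: "subspace (range (P i))"
  using linear_subspace_image[OF linear_P subspace_UNIV] .

lemma subspace_image_block: "subspace (T ` range (P i))"
  by (rule linear_subspace_image[OF linear_T subspace_block])

definition lag :: "real \<Rightarrow> 'a \<Rightarrow> 'b \<Rightarrow> real" where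
  "lag \<beta> z w = f z + w \<bullet> T z + \<beta> / 2 * (norm (T z))\<^sup>2"

definition lag_grad :: "real \<Rightarrow> 'a \<Rightarrow> 'b \<Rightarrow> 'a" where
  "lag_grad \<beta> z w = g z + adjoint T (w + \<beta> *\<^sub>R T z)"

lemma lag_grad_inner: "lag_grad \<beta> z w \<bullet> v = g z \<bullet> v + (w + \<beta> *\<^sub>R T z) \<bullet> T v"
  using adjoint_works[OF linear_T, of v "w + \<beta> *\<^sub>R T z"]
  by (simp add: lag_grad_def inner_add_left inner_add_right inner_commute)

lemma has_derivative_lag:
  assumes a: "(a has_derivative a') (at s)" and c: "(c has_derivative c') (at s)"
  shows "((\<lambda>s. lag \<beta> (a s) (c s)) has_derivative
    (\<lambda>h. lag_grad \<beta> (a s) (c s) \<bullet> a' h + c' h \<bullet> T (a s))) (at s)"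
proof -
  have f: "((\<lambda>s. f (a s)) has_derivative (\<lambda>h. a' h \<bullet> g (a s))) (at s)"
    using has_derivative_compose[OF a grad[unfolded gderiv_def]] .
  have t: "((\<lambda>s. T (a s)) has_derivative (\<lambda>h. T (a' h))) (at s)"
    using bounded_linear.has_derivative[OF linear_T[unfolded linear_conv_bounded_linear] a] .
  have "((\<lambda>s. f (a s) + c s \<bullet> T (a s) + \<beta> / 2 * (T (a s) \<bullet> T (a s))) has_derivative
    (\<lambda>h. a' h \<bullet> g (a s) + (c s \<bullet> T (a' h) + c' h \<bullet> T (a s))
      + \<beta> / 2 * (T (a s) \<bullet> T (a' h) + T (a' h) \<bullet> T (a s)))) (at s)"
    by (intro has_derivative_add has_derivative_mult_right has_derivative_inner f t c)
  moreover have "a' h \<bullet> g (a s) + (c s \<bullet> T (a' h) + c' h \<bullet> T (a s))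
      + \<beta> / 2 * (T (a s) \<bullet> T (a' h) + T (a' h) \<bullet> T (a s))
    = lag_grad \<beta> (a s) (c s) \<bullet> a' h + c' h \<bullet> T (a s)" for h
    unfolding lag_grad_inner by (simp add: inner_add_left inner_commute[of "T (a' h)" "T (a s)"] inner_commute[of "a' h"])
  ultimately show ?thesis unfolding lag_def power2_norm_eq_inner by (simp only:)
qed

lemma continuous_on_lag_grad:
  fixes a :: "'c::euclidean_space \<Rightarrow> 'a"
  assumes "continuous_on S a" "continuous_on S c"
  shows "continuous_on S (\<lambda>s. lag_grad \<beta> (a s) (c s))"
proof -
  have "continuous_on S (\<lambda>s. g (a s))"
    by (rule continuous_on_compose2[OF lipschitz_on_continuous_on[OF lip] assms(1)]) simp
  thus ?thesis
    unfolding lag_grad_def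
    by (intro continuous_on_add continuous_on_scaleR continuous_on_const assms
        linear_continuous_on_compose[OF _ linear_T]
        linear_continuous_on_compose[OF _ adjoint_linear[OF linear_T]])
qed

text \<open>
  The intermediate point of a sweep from \<open>b\<close> to \<open>a\<close> in which exactly the blocks below \<open>i\<close> have been
  updated.
\<close>

definition mix :: "nat \<Rightarrow> 'a \<Rightarrow> 'a \<Rightarrow> 'a" where
  "mix i a b = b + (\<Sum>j<i. P j (a - b))"

text \<open>
  A point is a minimizer along a block if no perturbation within the block improves it; stated this
  way, optimality does not require splitting the point into the block and the other variables.
\<close>

definition admm_step :: "real \<Rightarrow> 'b \<Rightarrow> 'a \<Rightarrow> 'a \<Rightarrow> bool" where
  "admm_step \<beta> w z z' \<longleftrightarrow>
     (\<forall>i\<le>N. \<forall>v\<in>range (P i). lag \<beta> (mix (Suc i) z' z) w \<le> lag \<beta> (mix (Suc i) z' z + v) w)"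

definition admm_sequence :: "real \<Rightarrow> (nat \<Rightarrow> 'a) \<Rightarrow> (nat \<Rightarrow> 'b) \<Rightarrow> bool" where
  "admm_sequence \<beta> z w \<longleftrightarrow>
     (\<forall>k. admm_step \<beta> (w k) (z k) (z (Suc k)) \<and> w (Suc k) = w k + \<beta> *\<^sub>R T (z (Suc k)))"

lemma admm_stepD:
  assumes "admm_step \<beta> w z z'" "i \<le> N" "v \<in> range (P i)"
  shows "lag \<beta> (mix (Suc i) z' z) w \<le> lag \<beta> (mix (Suc i) z' z + v) w"
  using assms unfolding admm_step_def by blast

lemma mix_0 [simp]: "mix 0 a b = b"
  by (simp add: mix_def)

lemma mix_Suc: "mix (Suc i) a b = mix i a b + P i (a - b)"
  by (simp add: mix_def add.assoc)

lemma mix_full: "mix (Suc N) a b = a"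
  using P_sum[of "a - b"] by (simp add: mix_def lessThan_Suc_atMost)

lemma P_sum_P: "P i (\<Sum>j\<in>J. P j z) = (if i \<in> J then P i z else 0)" if "finite J"
  using that by (simp add: linear_sum[OF linear_P] P_P)

lemma P_mix: "P i (mix (Suc i) a b) = P i a"
proof -
  have "P i (\<Sum>j<Suc i. P j (a - b)) = P i (a - b)" by (subst P_sum_P) auto
  thus ?thesis unfolding mix_def linear_add[OF linear_P] by (simp add: linear_diff[OF linear_P])
qed

lemma lag_add:
  "lag \<beta> (c + d) w = lag \<beta> c w + (f (c + d) - f c) + (w + \<beta> *\<^sub>R T c) \<bullet> T d + \<beta> / 2 * (norm (T d))\<^sup>2"
proof -
  have "(norm (T c + T d))\<^sup>2 = (norm (T c))\<^sup>2 + 2 * (T c \<bullet> T d) + (norm (T d))\<^sup>2"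
    by (simp add: power2_norm_eq_inner algebra_simps inner_commute)
  thus ?thesis by (simp add: lag_def T_simps algebra_simps)
qed

lemma stationary:
  assumes min: "\<And>v. v \<in> range (P i) \<Longrightarrow> lag \<beta> c w \<le> lag \<beta> (c + v) w" and v: "v \<in> range (P i)"
  shows "g c \<bullet> v + (w + \<beta> *\<^sub>R T c) \<bullet> T v = 0"
proof (rule zero_slope)
  fix t :: real
  have "t *\<^sub>R v \<in> range (P i)" using v subspace_block by (simp add: subspace_scale)
  from min[OF this] lag_add[of \<beta> c "t *\<^sub>R v" w]
  have "0 \<le> (f (c + t *\<^sub>R v) - f c) + (w + \<beta> *\<^sub>R T c) \<bullet> T (t *\<^sub>R v) + \<beta> / 2 * (norm (T (t *\<^sub>R v)))\<^sup>2"
    by linarith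
  also have "f (c + t *\<^sub>R v) - f c \<le> g c \<bullet> (t *\<^sub>R v) + L / 2 * (norm (t *\<^sub>R v))\<^sup>2"
    using lipschitz_gradient_upper[OF grad lip, of "c + t *\<^sub>R v" c] by simp
  finally show "0 \<le> t * (g c \<bullet> v + (w + \<beta> *\<^sub>R T c) \<bullet> T v)
      + t\<^sup>2 * (L / 2 * (norm v)\<^sup>2 + \<beta> / 2 * (norm (T v))\<^sup>2)"
    by (simp add: T_simps power_mult_distrib algebra_simps)
qed

text \<open>
  At a block minimizer the linear terms cancel, so moving away by \<open>d\<close> costs
  \<open>\<beta> / 2 * (norm (T d))\<^sup>2\<close> and gains at most \<open>L / 2 * (norm d)\<^sup>2\<close>, the nonconvexity of \<open>f\<close>.  Where the
  paths control \<open>norm d\<close> by \<open>norm (T d)\<close>, a large \<open>\<beta>\<close> wins.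
\<close>

lemma block_descent:
  assumes min: "\<And>v. v \<in> range (P i) \<Longrightarrow> lag \<beta> c w \<le> lag \<beta> (c + v) w"
    and d: "d \<in> range (P i)" "norm d \<le> M * norm (T d)" and "0 \<le> \<beta>"
  shows "lag \<beta> c w + (\<beta> / M\<^sup>2 - L) / 2 * (norm d)\<^sup>2 \<le> lag \<beta> (c - d) w"
proof -
  have "(norm d)\<^sup>2 \<le> (M * norm (T d))\<^sup>2" using d(2) by (intro power_mono) auto
  hence "\<beta> / (2 * M\<^sup>2) * (norm d)\<^sup>2 \<le> \<beta> / (2 * M\<^sup>2) * (M * norm (T d))\<^sup>2"
    using \<open>0 \<le> \<beta>\<close> by (intro mult_left_mono) auto
  also have "\<dots> = \<beta> / 2 * (norm (T d))\<^sup>2" using M_pos by (simp add: power_mult_distrib)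
  finally have 1: "\<beta> / (2 * M\<^sup>2) * (norm d)\<^sup>2 \<le> \<beta> / 2 * (norm (T d))\<^sup>2" .
  have 2: "f (c - d) \<ge> f c - g c \<bullet> d - L / 2 * (norm d)\<^sup>2"
    using lipschitz_gradient_lower[OF grad lip, of c "c - d"] by simp
  have 3: "lag \<beta> (c - d) w = lag \<beta> c w + (f (c - d) - f c) - (w + \<beta> *\<^sub>R T c) \<bullet> T d + \<beta> / 2 * (norm (T d))\<^sup>2"
    using lag_add[of \<beta> c "- d" w] by (simp add: T_simps)
  have "(\<beta> / M\<^sup>2 - L) / 2 * (norm d)\<^sup>2 = \<beta> / (2 * M\<^sup>2) * (norm d)\<^sup>2 - L / 2 * (norm d)\<^sup>2"
    by (simp add: left_diff_distrib diff_divide_distrib)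
  thus ?thesis using 1 2 3 stationary[OF min d(1)] by linarith
qed

definition on_paths :: "'a \<Rightarrow> bool" where
  "on_paths z \<longleftrightarrow> (\<forall>i\<le>N. P i z = G i (T (P i z)))"

text \<open>
  A block minimizer of the augmented Lagrangian minimizes \<open>f\<close> among the block values with the same
  image under \<open>T\<close>, since the other terms depend on that image only.  It therefore lies on the path,
  and this holds with the same path at every step, because \<open>G i\<close> does not depend on the other blocks.
\<close>

lemma admm_step_on_paths:
  assumes "admm_step \<beta> w z z'"
  shows "on_paths z'"
  unfolding on_paths_def
proof (intro allI impI)
  fix i assume i: "i \<le> N"
  define c where "c = mix (Suc i) z' z - P i z'"
  have c0: "P i c = 0" by (simp add: c_def P_simps P_mix P_P)
  have G: "G i (T (P i z')) \<in> range (P i)" "T (G i (T (P i z'))) = T (P i z')"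
    using path_in[OF i, of "T (P i z')"] by auto
  have "G i (T (P i z')) - P i z' \<in> range (P i)"
    using G subspace_block by (intro subspace_diff) auto
  hence "lag \<beta> (c + P i z') w \<le> lag \<beta> (c + P i z' + (G i (T (P i z')) - P i z')) w"
    using admm_stepD[OF assms i] unfolding c_def by simp
  also have "c + P i z' + (G i (T (P i z')) - P i z') = c + G i (T (P i z'))" by simp
  finally have "f (c + P i z') \<le> f (c + G i (T (P i z')))"
    by (simp add: lag_def T_simps G)
  thus "P i z' = G i (T (P i z'))"
    using i c0 by (intro path_unique[of i _ c]) auto
qed

lemma on_paths_contraction:
  assumes "on_paths z" "on_paths z'" "i \<le> N"
  shows "norm (P i (z' - z)) \<le> M * norm (T (P i (z' - z)))"
proof -
  have "norm (P i z' - P i z) = norm (G i (T (P i z')) - G i (T (P i z)))"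
    using assms unfolding on_paths_def by metis
  also have "\<dots> \<le> M * norm (T (P i z') - T (P i z))"
    using lipschitz_onD[OF path_lip[OF \<open>i \<le> N\<close>], of "T (P i z')" "T (P i z)"]
    by (auto simp: dist_norm)
  finally show ?thesis by (simp add: P_simps T_simps)
qed

lemma admm_step_decrease:
  assumes step: "admm_step \<beta> w z z'" and "on_paths z" and "0 \<le> \<beta>"
  shows "lag \<beta> z' w + (\<beta> / M\<^sup>2 - L) / 2 * (\<Sum>i\<le>N. (norm (P i (z' - z)))\<^sup>2) \<le> lag \<beta> z w"
proof -
  let ?\<kappa> = "(\<beta> / M\<^sup>2 - L) / 2"
  have "lag \<beta> (mix m z' z) w + ?\<kappa> * (\<Sum>i<m. (norm (P i (z' - z)))\<^sup>2) \<le> lag \<beta> z w"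
    if "m \<le> Suc N" for m
    using that
  proof (induction m)
    case (Suc m)
    have "lag \<beta> (mix (Suc m) z' z) w + ?\<kappa> * (norm (P m (z' - z)))\<^sup>2
        \<le> lag \<beta> (mix (Suc m) z' z - P m (z' - z)) w"
    proof (rule block_descent)
      show "lag \<beta> (mix (Suc m) z' z) w \<le> lag \<beta> (mix (Suc m) z' z + v) w" if "v \<in> range (P m)" for v
        using admm_stepD[OF step _ that] Suc.prems by simp
      show "norm (P m (z' - z)) \<le> M * norm (T (P m (z' - z)))"
        using Suc.prems by (intro on_paths_contraction assms admm_step_on_paths[OF step]) auto
    qed (use \<open>0 \<le> \<beta>\<close> in auto)
    thus ?case using Suc by (simp add: mix_Suc distrib_left)
  qed simp
  from this[of "Suc N"] show ?thesis by (simp add: mix_full lessThan_Suc_atMost)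
qed

lemma norm_le_sum_blocks: "(norm z)\<^sup>2 \<le> real (Suc N) * (\<Sum>i\<le>N. (norm (P i z))\<^sup>2)"
proof -
  have "norm z \<le> (\<Sum>i\<le>N. norm (P i z))"
    using norm_sum[of "\<lambda>i. P i z" "{..N}"] by (simp add: P_sum)
  hence "(norm z)\<^sup>2 \<le> (\<Sum>i\<le>N. norm (P i z))\<^sup>2" by (intro power_mono) auto
  also have "\<dots> \<le> (\<Sum>i\<le>N. (norm (P i z))\<^sup>2) * real (card {..N})"
    by (rule sum_squared_le_sum_of_squares)
  finally show ?thesis by (simp add: mult.commute)
qed

text \<open>
  On the image of the last block, \<open>\<lambda>u. G N u - G N 0\<close> is a right inverse of \<open>T\<close> with bound \<open>M\<close>.  It
  replaces a smallest-singular-value bound on \<open>T\<close> restricted to the last block.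
\<close>

lemma right_inverse_last:
  assumes "u \<in> range T"
  obtains v where "v \<in> range (P N)" "T v = u" "norm v \<le> M * norm u"
proof
  have u: "u \<in> T ` range (P N)" and 0: "0 \<in> T ` range (P N)"
    using assms feasible subspace_0[OF subspace_image_block] by auto
  show "G N u - G N 0 \<in> range (P N)"
    using path_in[of N] u 0 subspace_block by (intro subspace_diff) auto
  show "T (G N u - G N 0) = u" using path_in[of N] u 0 by (simp add: T_simps)
  show "norm (G N u - G N 0) \<le> M * norm u"
    using lipschitz_onD[OF path_lip, of N u 0] u 0 by (simp add: dist_norm)
qed

context
  fixes \<beta> :: real and z w
  assumes seq: "admm_sequence \<beta> z w"
begin

lemma seq_step: "admm_step \<beta> (w k) (z k) (z (Suc k))"
  and seq_w: "w (Suc k) = w k + \<beta> *\<^sub>R T (z (Suc k))"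
  using seq by (auto simp: admm_sequence_def)

lemma seq_on_paths: "on_paths (z (Suc k))"
  by (rule admm_step_on_paths[OF seq_step])

text \<open>
  The optimality condition of the last block; the multiplier update is exactly what absorbs its
  penalty term.
\<close>

lemma multiplier_equation:
  assumes "v \<in> range (P N)"
  shows "g (z (Suc k)) \<bullet> v + w (Suc k) \<bullet> T v = 0"
proof -
  have "g (z (Suc k)) \<bullet> v + (w k + \<beta> *\<^sub>R T (z (Suc k))) \<bullet> T v = 0"
    using admm_stepD[OF seq_step[of k], of N] assms by (intro stationary[of N]) (auto simp: mix_full)
  thus ?thesis by (simp add: seq_w)
qed

text \<open>
  The difference of two consecutive multiplier equations, tested with the vector \<open>v\<close> that \<open>T\<close> maps to
  the multiplier increment.  The increment lies in \<open>range T\<close> by the update rule.  The equation holds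
  from iterate 1 on only, whence the shifted indices here and below.
\<close>

lemma multiplier_step:
  "norm (w (Suc (Suc k)) - w (Suc k)) \<le> L * M * norm (z (Suc (Suc k)) - z (Suc k))"
proof -
  let ?dw = "w (Suc (Suc k)) - w (Suc k)" and ?dg = "g (z (Suc (Suc k))) - g (z (Suc k))"
  have "?dw = T (\<beta> *\<^sub>R z (Suc (Suc k)))" by (simp add: seq_w T_simps)
  then obtain v where v: "v \<in> range (P N)" "T v = ?dw" "norm v \<le> M * norm ?dw"
    by (metis right_inverse_last rangeI)
  have "?dw \<bullet> T v = - (?dg \<bullet> v)"
    using multiplier_equation[OF v(1), of k] multiplier_equation[OF v(1), of "Suc k"]
    by (simp add: inner_diff_left)
  hence "(norm ?dw)\<^sup>2 = - (?dg \<bullet> v)" by (simp add: v power2_norm_eq_inner)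
  also have "\<dots> \<le> norm ?dg * norm v" using Cauchy_Schwarz_ineq2[of ?dg v] by linarith
  also have "\<dots> \<le> (L * norm (z (Suc (Suc k)) - z (Suc k))) * (M * norm ?dw)"
    using lipschitz_onD[OF lip, of "z (Suc (Suc k))" "z (Suc k)"] v L_nonneg
    by (intro mult_mono) (auto simp: dist_norm)
  finally have "norm ?dw * norm ?dw \<le> norm ?dw * (L * M * norm (z (Suc (Suc k)) - z (Suc k)))"
    by (simp add: power2_eq_square mult_ac)
  thus ?thesis
    using L_nonneg M_pos by (cases "?dw = 0") (auto simp: mult_le_cancel_left_pos)
qed

end

section \<open>Descent, boundedness and gradient bound for large \<open>\<beta>\<close>\<close>

text \<open>
  The first summand makes the decrease of the block updates exceed the increase of the multiplier
  update by the full squared step; \<open>L * M\<^sup>2 + 1\<close> serves the lower bound of the Lagrangian and the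
  existence of minimizers.
\<close>

definition \<beta>_min :: real where
  "\<beta>_min = M\<^sup>2 * (L + 2 * (real (Suc N) * ((L * M)\<^sup>2 + 1))) + L * M\<^sup>2 + 1"

lemma \<beta>_min_le:
  assumes "\<beta>_min \<le> \<beta>"
  shows "1 \<le> \<beta>" "L * M\<^sup>2 + 1 \<le> \<beta>" "real (Suc N) * ((L * M)\<^sup>2 + 1) \<le> (\<beta> / M\<^sup>2 - L) / 2"
proof -
  let ?c = "L + 2 * (real (Suc N) * ((L * M)\<^sup>2 + 1))"
  have "0 \<le> ?c" using L_nonneg by simp
  hence "0 \<le> M\<^sup>2 * ?c" "0 \<le> L * M\<^sup>2" using L_nonneg by auto
  thus "1 \<le> \<beta>" "L * M\<^sup>2 + 1 \<le> \<beta>" using assms unfolding \<beta>_min_def by linarith+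
  have "?c * M\<^sup>2 \<le> \<beta>"
    using assms \<open>0 \<le> L * M\<^sup>2\<close> unfolding \<beta>_min_def by (simp only: mult.commute[of "M\<^sup>2"])
  hence "?c \<le> \<beta> / M\<^sup>2" using M_pos by (simp add: pos_le_divide_eq)
  thus "real (Suc N) * ((L * M)\<^sup>2 + 1) \<le> (\<beta> / M\<^sup>2 - L) / 2" by argo
qed

context
  fixes \<beta> :: real
  assumes beta: "\<beta>_min \<le> \<beta>"
begin

text \<open>
  The multiplier update raises the Lagrangian by \<open>(norm (\<Delta>w))\<^sup>2 / \<beta>\<close>, which \<open>multiplier_step\<close> bounds by
  \<open>(L * M)\<^sup>2 * (norm (\<Delta>z))\<^sup>2\<close>; the block updates lower it by more.
\<close>

lemma sequence_decrease:
  assumes seq: "admm_sequence \<beta> z w"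
  shows "lag \<beta> (z (Suc (Suc k))) (w (Suc (Suc k))) + (norm (z (Suc (Suc k)) - z (Suc k)))\<^sup>2
    \<le> lag \<beta> (z (Suc k)) (w (Suc k))"
proof -
  let ?dz = "z (Suc (Suc k)) - z (Suc k)" and ?dw = "w (Suc (Suc k)) - w (Suc k)"
    and ?S = "\<Sum>i\<le>N. (norm (P i (z (Suc (Suc k)) - z (Suc k))))\<^sup>2"
  have "lag \<beta> (z (Suc (Suc k))) (w (Suc k)) + (\<beta> / M\<^sup>2 - L) / 2 * ?S \<le> lag \<beta> (z (Suc k)) (w (Suc k))"
    using \<beta>_min_le[OF beta] by (intro admm_step_decrease seq_step[OF seq] seq_on_paths[OF seq]) auto
  moreover have "((L * M)\<^sup>2 + 1) * (norm ?dz)\<^sup>2 \<le> (\<beta> / M\<^sup>2 - L) / 2 * ?S"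
  proof -
    have "((L * M)\<^sup>2 + 1) * (norm ?dz)\<^sup>2 \<le> ((L * M)\<^sup>2 + 1) * (real (Suc N) * ?S)"
      by (intro mult_left_mono norm_le_sum_blocks) auto
    also have "\<dots> = real (Suc N) * ((L * M)\<^sup>2 + 1) * ?S" by (simp only: mult_ac)
    also have "\<dots> \<le> (\<beta> / M\<^sup>2 - L) / 2 * ?S"
      by (intro mult_right_mono \<beta>_min_le[OF beta] sum_nonneg) auto
    finally show ?thesis .
  qed
  moreover have "lag \<beta> (z (Suc (Suc k))) (w (Suc (Suc k))) = lag \<beta> (z (Suc (Suc k))) (w (Suc k)) + (norm ?dw)\<^sup>2 / \<beta>"
    using \<beta>_min_le(1)[OF beta]
    by (simp add: lag_def seq_w[OF seq, of "Suc k"] inner_add_left dot_square_norm power2_eq_square)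
  moreover have "(norm ?dw)\<^sup>2 / \<beta> \<le> (L * M)\<^sup>2 * (norm ?dz)\<^sup>2"
  proof -
    have "(norm ?dw)\<^sup>2 / \<beta> \<le> (norm ?dw)\<^sup>2"
      using \<beta>_min_le(1)[OF beta] by (simp add: divide_le_eq mult_left_le)
         (smt (verit) mult_left_mono mult_cancel_left2 zero_le_power2)
    also have "\<dots> \<le> (L * M * norm ?dz)\<^sup>2" by (intro power_mono multiplier_step[OF seq]) auto
    finally show ?thesis by (simp add: power_mult_distrib)
  qed
  ultimately show ?thesis unfolding distrib_right by argo
qed

text \<open>
  Correcting the last block with the right inverse of \<open>T\<close> yields a feasible \<open>z'\<close>.  By the multiplier
  equation, the term \<open>w \<bullet> T z\<close> of the Lagrangian is the first-order change of \<open>f\<close> under this correction,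
  and the penalty pays for the second-order change.  So the Lagrangian dominates \<open>f\<close> on the
  constraint set, where coercivity applies.
\<close>

lemma feasible_comparison:
  assumes seq: "admm_sequence \<beta> z w"
  obtains z' where "T z' = 0" "norm (z (Suc k) - z') \<le> M * norm (T (z (Suc k)))"
    "f z' + (norm (T (z (Suc k))))\<^sup>2 / 2 \<le> lag \<beta> (z (Suc k)) (w (Suc k))"
proof -
  let ?z = "z (Suc k)" and ?w = "w (Suc k)"
  have "T (- ?z) \<in> range T" by (rule rangeI)
  then obtain v where v: "v \<in> range (P N)" "T v = T (- ?z)" "norm v \<le> M * norm (T (- ?z))"
    by (rule right_inverse_last)
  have norm_v: "norm v \<le> M * norm (T ?z)" using v(3) by (simp add: T_simps)
  have "f (?z + v) \<le> f ?z + g ?z \<bullet> v + L / 2 * (norm v)\<^sup>2"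
    using lipschitz_gradient_upper[OF grad lip, of "?z + v" ?z] by simp
  moreover have "g ?z \<bullet> v = ?w \<bullet> T ?z"
    using multiplier_equation[OF seq v(1), of k] by (simp add: v T_simps)
  moreover have "L / 2 * (norm v)\<^sup>2 \<le> L / 2 * (M * norm (T ?z))\<^sup>2"
    using norm_v L_nonneg by (intro mult_left_mono power_mono) auto
  moreover have "(L * M\<^sup>2 + 1) / 2 * (norm (T ?z))\<^sup>2 \<le> \<beta> / 2 * (norm (T ?z))\<^sup>2"
    using \<beta>_min_le[OF beta] by (intro mult_right_mono) auto
  ultimately have "f (?z + v) + (norm (T ?z))\<^sup>2 / 2 \<le> lag \<beta> ?z ?w"
    by (simp add: lag_def power_mult_distrib algebra_simps add_divide_distrib)
  thus thesis using that[of "?z + v"] v norm_v by (simp add: T_simps)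
qed

lemma continuous_f: "continuous_on S f"
  using grad unfolding gderiv_def
  by (intro continuous_at_imp_continuous_on ballI) (blast intro: has_derivative_continuous)

text \<open>
  The Lagrangian stays below its value at iterate 1, so by \<open>feasible_comparison\<close> and coercivity the
  feasible companions \<open>z'\<close> and the residuals \<open>T z\<close> are bounded, hence so are the iterates.  The
  multipliers are only controlled modulo the orthogonal complement of \<open>range T\<close>, but they move within
  \<open>w 0 + range T\<close>.
\<close>

lemma sequence_bounded:
  assumes seq: "admm_sequence \<beta> z w"
  shows "bounded (range z)" "bounded (range w)"
proof -
  define l where "l = lag \<beta> (z 1) (w 1)"
  have lag_le: "lag \<beta> (z (Suc k)) (w (Suc k)) \<le> l" for k
  proof (induction k)
    case (Suc k)
    thus ?case using sequence_decrease[OF seq, of k]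
      by (smt (verit) zero_le_power2)
  qed (simp add: l_def)
  have "eventually (\<lambda>z. l < f z) (inf at_infinity (principal {z. T z = 0}))"
    using coercive unfolding coercive_on_def filterlim_at_top_dense by blast
  then obtain R where R: "\<And>z. T z = 0 \<Longrightarrow> R \<le> norm z \<Longrightarrow> l < f z"
    unfolding eventually_inf_principal eventually_at_infinity by blast
  obtain m where m: "\<And>z. z \<in> cball 0 R \<Longrightarrow> m \<le> f z"
  proof -
    have "compact (f ` cball 0 R)" by (intro compact_continuous_image continuous_f) auto
    hence "bdd_below (f ` cball 0 R)" by (intro bounded_imp_bdd_below compact_imp_bounded)
    then obtain m where "\<forall>x\<in>cball 0 R. m \<le> f x" unfolding bdd_below_def by blast
    thus thesis by (intro that) blast
  qed
  have bound: "norm (z (Suc k)) \<le> R + M * sqrt (2 * (l - m))" for k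
  proof -
    obtain z' where z': "T z' = 0" "norm (z (Suc k) - z') \<le> M * norm (T (z (Suc k)))"
      "f z' + (norm (T (z (Suc k))))\<^sup>2 / 2 \<le> lag \<beta> (z (Suc k)) (w (Suc k))"
      by (rule feasible_comparison[OF seq])
    have "f z' \<le> l" using z'(3) lag_le[of k] by (smt (verit) zero_le_power2 zero_le_divide_iff)
    hence nz': "norm z' \<le> R" using R[OF z'(1)] by fastforce
    hence "m \<le> f z'" using m by simp
    hence "(norm (T (z (Suc k))))\<^sup>2 \<le> 2 * (l - m)" using z'(3) lag_le[of k] by argo
    hence "norm (T (z (Suc k))) \<le> sqrt (2 * (l - m))" by (rule real_le_rsqrt)
    hence "M * norm (T (z (Suc k))) \<le> M * sqrt (2 * (l - m))" using M_pos by simp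
    moreover have "norm (z (Suc k)) \<le> norm z' + norm (z (Suc k) - z')"
      using norm_triangle_ineq[of z' "z (Suc k) - z'"] by simp
    ultimately show ?thesis using z'(2) nz' by linarith
  qed
  have shift: "bounded (range u)" if "bounded (range (\<lambda>k. u (Suc k)))" for u :: "nat \<Rightarrow> 'c::real_normed_vector"
  proof -
    have "range u = insert (u 0) (range (\<lambda>k. u (Suc k)))"
      by (auto simp: image_iff) (metis not0_implies_Suc)
    thus ?thesis using that by simp
  qed
  have bz: "bounded (range (\<lambda>k. z (Suc k)))"
    unfolding bounded_iff using bound by blast
  thus "bounded (range z)" by (rule shift)
  have "bounded (g ` range (\<lambda>k. z (Suc k)))"
  proof -
    have "L-lipschitz_on (range (\<lambda>k. z (Suc k))) g" using lip by (rule lipschitz_on_subset) simp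
    thus ?thesis using bz by (intro bounded_uniformly_continuous_image lipschitz_on_uniformly_continuous)
  qed
  then obtain C where C: "\<And>k. norm (g (z (Suc k))) \<le> C" unfolding bounded_iff by auto
  have "norm (w (Suc k) - w 0) \<le> C * M + norm (w 0)" for k
  proof -
    let ?d = "w (Suc k) - w 0"
    have "w k - w 0 \<in> range T" for k
    proof (induction k)
      case 0
      show ?case using linear_0[OF linear_T] by (metis cancel_comm_monoid_add_class.diff_cancel rangeI)
    next
      case (Suc k)
      then obtain u where "w k - w 0 = T u" by blast
      hence "w (Suc k) - w 0 = T (u + \<beta> *\<^sub>R z (Suc k))"
        by (simp add: seq_w[OF seq] T_simps algebra_simps)
      thus ?case by blast
    qed
    from right_inverse_last[OF this] obtain v where v: "v \<in> range (P N)" "T v = ?d" "norm v \<le> M * norm ?d" .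
    have "(norm ?d)\<^sup>2 = w (Suc k) \<bullet> ?d - w 0 \<bullet> ?d" by (simp add: power2_norm_eq_inner inner_diff_left)
    also have "w (Suc k) \<bullet> ?d = - (g (z (Suc k)) \<bullet> v)" using multiplier_equation[OF seq v(1), of k] v by simp
    also have "- (g (z (Suc k)) \<bullet> v) - w 0 \<bullet> ?d \<le> norm (g (z (Suc k))) * norm v + norm (w 0) * norm ?d"
      using Cauchy_Schwarz_ineq2[of "g (z (Suc k))" v] Cauchy_Schwarz_ineq2[of "w 0" ?d] by linarith
    also have "\<dots> \<le> C * (M * norm ?d) + norm (w 0) * norm ?d"
      using C[of k] v by (intro add_right_mono mult_mono) (auto intro: order_trans[OF norm_ge_zero])
    finally have "norm ?d * norm ?d \<le> norm ?d * (C * M + norm (w 0))"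
      by (simp add: power2_eq_square algebra_simps)
    moreover have "0 \<le> C" using C[of k] by (auto intro: order_trans[OF norm_ge_zero])
    ultimately show ?thesis using M_pos by (cases "?d = 0") (auto simp: mult_le_cancel_left_pos)
  qed
  hence "norm (w (Suc k)) \<le> C * M + 2 * norm (w 0)" for k
    using norm_triangle_sub[of "w (Suc k)" "w 0"] by (smt (verit))
  hence "bounded (range (\<lambda>k. w (Suc k)))" unfolding bounded_iff by blast
  thus "bounded (range w)" by (rule shift)
qed

text \<open>
  On block \<open>i\<close> the gradient vanishes at the mixed point right after the update of that block, with the
  old multiplier.  The end of the sweep differs from it by the later block steps and the multiplier
  increment only.
\<close>

lemma lag_grad_bound:
  "\<exists>C>0. \<forall>z w k. admm_sequence \<beta> z w \<longrightarrow>
      norm (lag_grad \<beta> (z (Suc k)) (w (Suc k))) \<le> C * (norm (z (Suc k) - z k) + norm (w (Suc k) - w k))"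
proof -
  obtain K where K: "0 < K" "\<And>x. norm (T x) \<le> K * norm x"
    using linear_bounded_pos[OF linear_T] by blast
  define D where "D = L * real (Suc N) + K + \<beta> * K * real (Suc N) * K"
  have beta0: "0 \<le> \<beta>" using \<beta>_min_le(1)[OF beta] by simp
  have D: "0 \<le> D" unfolding D_def using L_nonneg K beta0 by simp
  have bound: "norm (lag_grad \<beta> (z (Suc k)) (w (Suc k)))
      \<le> real (Suc N) * (D * (norm (z (Suc k) - z k) + norm (w (Suc k) - w k)))"
    if seq: "admm_sequence \<beta> z w" for z w k
  proof -
    let ?dz = "z (Suc k) - z k" and ?dw = "w (Suc k) - w k"
    let ?y = "lag_grad \<beta> (z (Suc k)) (w (Suc k))"
    let ?E = "D * (norm ?dz + norm ?dw)"
    have block: "?y \<bullet> v \<le> ?E * norm v" if v: "v \<in> range (P i)" and i: "i \<le> N" for v i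
    proof -
      let ?c = "mix (Suc i) (z (Suc k)) (z k)"
      have "z (Suc k) - ?c = (\<Sum>j\<in>{..N} - {..<Suc i}. P j ?dz)"
      proof -
        have "(\<Sum>j\<in>{..N}. P j ?dz) = (\<Sum>j<Suc i. P j ?dz) + (\<Sum>j\<in>{..N} - {..<Suc i}. P j ?dz)"
          using i by (subst sum.subset_diff[of "{..<Suc i}" "{..N}"]) auto
        thus ?thesis unfolding mix_def P_sum by (simp add: algebra_simps del: sum.lessThan_Suc)
      qed
      also have "norm \<dots> \<le> (\<Sum>j\<in>{..N} - {..<Suc i}. norm (P j ?dz))" by (rule norm_sum)
      also have "\<dots> \<le> (\<Sum>j\<le>N. norm (P j ?dz))" by (intro sum_mono2) auto
      also have "\<dots> \<le> (\<Sum>j\<le>N. norm ?dz)" by (intro sum_mono P_norm)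
      finally have c: "norm (z (Suc k) - ?c) \<le> real (Suc N) * norm ?dz" by simp
      have "g ?c \<bullet> v + (w k + \<beta> *\<^sub>R T ?c) \<bullet> T v = 0"
        using admm_stepD[OF seq_step[OF seq, of k] i] v by (intro stationary[of i]) auto
      hence "?y \<bullet> v = (g (z (Suc k)) - g ?c) \<bullet> v + (?dw + \<beta> *\<^sub>R T (z (Suc k) - ?c)) \<bullet> T v"
        unfolding lag_grad_inner by (simp add: T_simps algebra_simps)
      also have "\<dots> \<le> norm (g (z (Suc k)) - g ?c) * norm v
          + norm (?dw + \<beta> *\<^sub>R T (z (Suc k) - ?c)) * norm (T v)"
        by (intro add_mono norm_cauchy_schwarz)
      also have "\<dots> \<le> (L * (real (Suc N) * norm ?dz)) * norm v
          + (norm ?dw + \<beta> * (K * (real (Suc N) * norm ?dz))) * (K * norm v)"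
      proof (intro add_mono mult_mono)
        have "norm (g (z (Suc k)) - g ?c) \<le> L * norm (z (Suc k) - ?c)"
          using lipschitz_onD[OF lip, of "z (Suc k)" ?c] by (simp add: dist_norm)
        also have "\<dots> \<le> L * (real (Suc N) * norm ?dz)" using c L_nonneg by (rule mult_left_mono)
        finally show "norm (g (z (Suc k)) - g ?c) \<le> L * (real (Suc N) * norm ?dz)" .
        have "norm (T (z (Suc k) - ?c)) \<le> K * norm (z (Suc k) - ?c)" by (rule K)
        also have "\<dots> \<le> K * (real (Suc N) * norm ?dz)" using c K by (intro mult_left_mono) auto
        finally have "norm (\<beta> *\<^sub>R T (z (Suc k) - ?c)) \<le> \<beta> * (K * (real (Suc N) * norm ?dz))"
          using beta0 by (simp add: mult_left_mono)
        thus "norm (?dw + \<beta> *\<^sub>R T (z (Suc k) - ?c)) \<le> norm ?dw + \<beta> * (K * (real (Suc N) * norm ?dz))"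
          by (meson add_left_mono norm_triangle_ineq order_trans)
      qed (use K beta0 L_nonneg in auto)
      also have "\<dots> = (L * real (Suc N) * norm ?dz + K * norm ?dw + \<beta> * K * real (Suc N) * K * norm ?dz) * norm v"
        by (simp only: algebra_simps)
      also have "\<dots> \<le> ?E * norm v"
      proof (rule mult_right_mono)
        have "0 \<le> K * norm ?dz" "0 \<le> L * real (Suc N) * norm ?dw" "0 \<le> \<beta> * K * real (Suc N) * K * norm ?dw"
          using K beta0 L_nonneg by auto
        thus "L * real (Suc N) * norm ?dz + K * norm ?dw + \<beta> * K * real (Suc N) * K * norm ?dz \<le> ?E"
          unfolding D_def distrib_left distrib_right by linarith
      qed simp
      finally show ?thesis .
    qed
    have E: "0 \<le> ?E" using D by simp
    have "(norm ?y)\<^sup>2 = ?y \<bullet> (\<Sum>i\<le>N. P i ?y)" by (simp add: P_sum power2_norm_eq_inner)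
    also have "\<dots> = (\<Sum>i\<le>N. ?y \<bullet> P i ?y)" by (rule inner_sum_right)
    also have "\<dots> \<le> (\<Sum>i\<le>N. ?E * norm ?y)"
    proof (rule sum_mono)
      fix i assume "i \<in> {..N}"
      hence "?y \<bullet> P i ?y \<le> ?E * norm (P i ?y)" by (intro block[of _ i]) auto
      also have "\<dots> \<le> ?E * norm ?y" using E by (intro mult_left_mono P_norm)
      finally show "?y \<bullet> P i ?y \<le> ?E * norm ?y" .
    qed
    finally have "norm ?y * norm ?y \<le> norm ?y * (real (Suc N) * ?E)"
      by (simp add: power2_eq_square mult_ac)
    thus ?thesis using E by (cases "?y = 0") (auto simp: mult_le_cancel_left_pos)
  qed
  show ?thesis
  proof (intro exI[of _ "real (Suc N) * (D + 1)"] conjI allI impI)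
    show "0 < real (Suc N) * (D + 1)" using D by simp
    fix z w k assume "admm_sequence \<beta> z w"
    note bound[OF this, of k]
    also have "real (Suc N) * (D * (norm (z (Suc k) - z k) + norm (w (Suc k) - w k)))
       \<le> real (Suc N) * ((D + 1) * (norm (z (Suc k) - z k) + norm (w (Suc k) - w k)))"
      by (intro mult_left_mono mult_right_mono) auto
    finally show "norm (lag_grad \<beta> (z (Suc k)) (w (Suc k)))
       \<le> real (Suc N) * (D + 1) * (norm (z (Suc k) - z k) + norm (w (Suc k) - w k))"
      by (simp only: mult.assoc)
  qed
qed

section \<open>Existence of the iterates\<close>

text \<open>
  Minimizing over the block reduces to minimizing along the path, as a function of \<open>u = T v\<close>.  There
  \<open>norm (G i u)\<close> grows at most like \<open>M * norm u\<close>, so for \<open>\<beta> > L * M\<^sup>2\<close> the penalty beats the at most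
  quadratic decrease of \<open>f\<close>, and a minimum exists on the closed subspace of all \<open>u\<close>.
\<close>

lemma block_minimizer_exists:
  assumes i: "i \<le> N"
  obtains d where "d \<in> range (P i)"
    "\<And>v. v \<in> range (P i) \<Longrightarrow> lag \<beta> (c + d) w \<le> lag \<beta> (c + d + v) w"
proof -
  define S where "S = T ` range (P i)"
  define b where "b = c - P i c"
  define h where "h u = lag \<beta> (b + G i u) w" for u
  have b0: "P i b = 0" by (simp add: b_def P_simps P_P)
  have S: "subspace S" unfolding S_def by (rule subspace_image_block)
  have G: "G i u \<in> range (P i)" "T (G i u) = u" if "u \<in> S" for u
    using path_in[OF i] that unfolding S_def by auto
  have S0: "0 \<in> S" using S by (rule subspace_0)
  define a where "a = b + G i 0"
  define C where "C = norm (g a) * M + norm (w + \<beta> *\<^sub>R T a)"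
  have lower: "h 0 - C * norm u + (norm u)\<^sup>2 / 2 \<le> h u" if u: "u \<in> S" for u
  proof -
    define d where "d = G i u - G i 0"
    have d: "norm d \<le> M * norm u"
      using lipschitz_onD[OF path_lip[OF i], of u 0] u S0 by (simp add: S_def d_def dist_norm)
    have Td: "T d = u" using G u S0 by (simp add: d_def T_simps)
    have "h u = lag \<beta> (a + d) w" by (simp add: h_def a_def d_def)
    also have "\<dots> = h 0 + (f (a + d) - f a) + (w + \<beta> *\<^sub>R T a) \<bullet> u + \<beta> / 2 * (norm u)\<^sup>2"
      by (simp add: lag_add Td h_def a_def)
    finally have 1: "h u = h 0 + (f (a + d) - f a) + (w + \<beta> *\<^sub>R T a) \<bullet> u + \<beta> / 2 * (norm u)\<^sup>2" .
    have 2: "f (a + d) - f a \<ge> g a \<bullet> d - L / 2 * (norm d)\<^sup>2"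
      using lipschitz_gradient_lower[OF grad lip, of a "a + d"] by simp
    have 3: "\<bar>g a \<bullet> d\<bar> \<le> norm (g a) * (M * norm u)"
      using Cauchy_Schwarz_ineq2[of "g a" d] mult_left_mono[OF d, of "norm (g a)"] by simp
    have 4: "\<bar>(w + \<beta> *\<^sub>R T a) \<bullet> u\<bar> \<le> norm (w + \<beta> *\<^sub>R T a) * norm u"
      by (rule Cauchy_Schwarz_ineq2)
    have 5: "L / 2 * (norm d)\<^sup>2 \<le> L / 2 * (M * norm u)\<^sup>2"
      using d L_nonneg by (intro mult_left_mono power_mono) auto
    have 6: "(L * M\<^sup>2 + 1) / 2 * (norm u)\<^sup>2 \<le> \<beta> / 2 * (norm u)\<^sup>2"
      using \<beta>_min_le[OF beta] by (intro mult_right_mono) auto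
    have 7: "L / 2 * (M * norm u)\<^sup>2 + (norm u)\<^sup>2 / 2 = (L * M\<^sup>2 + 1) / 2 * (norm u)\<^sup>2"
      by (simp add: power_mult_distrib field_simps)
    have 8: "C * norm u = norm (g a) * (M * norm u) + norm (w + \<beta> *\<^sub>R T a) * norm u"
      by (simp add: C_def algebra_simps)
    show ?thesis using 1 2 3 4 5 6 7 8 by linarith
  qed
  have C: "0 \<le> C" using M_pos by (simp add: C_def)
  have "continuous_on S (G i)"
    using path_lip[OF i] unfolding S_def by (rule lipschitz_on_continuous_on)
  hence "continuous_on S h"
    unfolding h_def lag_def
    by (intro continuous_intros continuous_on_compose2[OF continuous_f[of UNIV]]
        linear_continuous_on_compose[OF _ linear_T]) auto
  moreover have "compact (S \<inter> cball 0 (2 * C))"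
    using closed_subspace[OF S] by (intro closed_Int_compact) auto
  moreover have "0 \<in> S \<inter> cball 0 (2 * C)" using S0 C by simp
  ultimately obtain u where u: "u \<in> S" "\<And>u'. u' \<in> S \<Longrightarrow> norm u' \<le> 2 * C \<Longrightarrow> h u \<le> h u'"
    using continuous_attains_inf[of "S \<inter> cball 0 (2 * C)" h]
    by (metis IntD1 IntI continuous_on_subset empty_iff inf_le1 mem_cball_0)
  \<comment> \<open>Beyond radius \<open>2 * C\<close> the lower bound is at least \<open>h 0\<close>, and 0 is in the compact part.\<close>
  have min: "h u \<le> h u'" if "u' \<in> S" for u'
  proof (cases "norm u' \<le> 2 * C")
    case False
    hence "2 * C * norm u' \<le> norm u' * norm u'" by (intro mult_right_mono) auto
    hence "C * norm u' \<le> (norm u')\<^sup>2 / 2" by (simp add: power2_eq_square)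
    hence "h 0 \<le> h u'" using lower[OF that] by linarith
    thus ?thesis using u(2)[OF S0] C by simp
  qed (use u that in auto)
  show thesis
  proof (rule that[of "G i u - P i c"])
    show "G i u - P i c \<in> range (P i)"
      using G[OF u(1)] subspace_block by (intro subspace_diff) auto
    fix v assume v: "v \<in> range (P i)"
    let ?x = "G i u + v"
    have x: "?x \<in> range (P i)" using G[OF u(1)] v subspace_block by (intro subspace_add) auto
    hence "T ?x \<in> S" unfolding S_def by blast
    have "lag \<beta> (c + (G i u - P i c)) w = h u" by (simp add: h_def b_def algebra_simps)
    also have "\<dots> \<le> h (T ?x)" using \<open>T ?x \<in> S\<close> by (rule min)
    also have "\<dots> \<le> lag \<beta> (b + ?x) w"
      using path_min[OF i x b0] G(2)[OF \<open>T ?x \<in> S\<close>] by (simp add: h_def lag_def T_simps)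
    also have "b + ?x = c + (G i u - P i c) + v" by (simp add: b_def)
    finally show "lag \<beta> (c + (G i u - P i c)) w \<le> lag \<beta> (c + (G i u - P i c) + v) w" .
  qed
qed

text \<open>
  Updating block \<open>m\<close> leaves the mixed points of the earlier blocks unchanged, so the new point can be
  built block by block.
\<close>

lemma admm_step_exists: "\<exists>z'. admm_step \<beta> w z z'"
proof -
  have "\<exists>z'. \<forall>i<m. \<forall>v\<in>range (P i). lag \<beta> (mix (Suc i) z' z) w \<le> lag \<beta> (mix (Suc i) z' z + v) w"
    if "m \<le> Suc N" for m
    using that
  proof (induction m)
    case (Suc m)
    then obtain z' where z': "\<And>i v. i < m \<Longrightarrow> v \<in> range (P i) \<Longrightarrow>
        lag \<beta> (mix (Suc i) z' z) w \<le> lag \<beta> (mix (Suc i) z' z + v) w"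
      by (metis Suc_leD)
    obtain d where d: "d \<in> range (P m)"
      "\<And>v. v \<in> range (P m) \<Longrightarrow> lag \<beta> (mix m z' z + d) w \<le> lag \<beta> (mix m z' z + d + v) w"
      using block_minimizer_exists[of m "mix m z' z" w] Suc.prems by auto
    \<comment> \<open>Block \<open>m\<close> of \<open>z'\<close> is still arbitrary: it is reset to its old value and then moved by \<open>d\<close>.\<close>
    define z'' where "z'' = z' + P m (z - z') + d"
    have P_m: "P m (z'' - z) = d"
      using P_of_range[OF d(1)] by (simp add: z''_def P_simps P_P)
    have P_j: "P j (z'' - z) = P j (z' - z)" if "j \<noteq> m" for j
    proof -
      have "P j d = 0" using d(1) P_P that by auto
      thus ?thesis using that by (simp add: z''_def P_simps P_P)
    qed
    have mix_eq: "mix j z'' z = mix j z' z" if "j \<le> m" for j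
      unfolding mix_def using that by (intro arg_cong2[where f = "(+)"] refl sum.cong P_j) auto
    show ?case
    proof (intro exI[of _ z''] allI impI ballI)
      fix i v assume "i < Suc m" and v: "v \<in> range (P i)"
      then consider "i < m" | "i = m" by linarith
      thus "lag \<beta> (mix (Suc i) z'' z) w \<le> lag \<beta> (mix (Suc i) z'' z + v) w"
      proof cases
        case 1
        thus ?thesis using z' v mix_eq[of "Suc i"] by simp
      next
        case 2
        thus ?thesis using d(2) v mix_eq[of m] by (simp add: mix_Suc[of m z''] P_m)
      qed
    qed
  qed simp
  from this[of "Suc N"] show ?thesis unfolding admm_step_def by (auto simp: less_Suc_eq_le)
qed

lemma admm_sequence_exists: "\<exists>z w. z 0 = z\<^sub>0 \<and> w 0 = w\<^sub>0 \<and> admm_sequence \<beta> z w"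
proof -
  define next_z where "next_z s = (SOME z'. admm_step \<beta> (snd s) (fst s) z')" for s
  have next_z: "admm_step \<beta> (snd s) (fst s) (next_z s)" for s
    unfolding next_z_def using admm_step_exists by (rule someI_ex)
  define s where "s = rec_nat (z\<^sub>0, w\<^sub>0) (\<lambda>_ s. (next_z s, snd s + \<beta> *\<^sub>R T (next_z s)))"
  have "s 0 = (z\<^sub>0, w\<^sub>0)" "s (Suc k) = (next_z (s k), snd (s k) + \<beta> *\<^sub>R T (next_z (s k)))" for k
    by (simp_all add: s_def)
  thus ?thesis
    using next_z by (intro exI[of _ "fst \<circ> s"] exI[of _ "snd \<circ> s"]) (simp add: admm_sequence_def)
qed

end

end

section \<open>ADMM as a block problem\<close>

definition constraint_map :: "real ^ 'n ^ 'm \<Rightarrow> real ^ 'q ^ 'm \<Rightarrow> (real ^ 'n) \<times> (real ^ 'q) \<Rightarrow> real ^ 'm" where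
  "constraint_map A B z = A *v fst z + B *v snd z"

definition block_proj ::
    "('n::finite \<Rightarrow> nat) \<Rightarrow> nat \<Rightarrow> nat \<Rightarrow> (real ^ 'n) \<times> (real ^ 'q) \<Rightarrow> (real ^ 'n) \<times> (real ^ 'q)" where
  "block_proj blk p i z = (if i = Suc p then (0, snd z) else (block_part blk i (fst z), 0))"

definition block_path ::
    "nat \<Rightarrow> (nat \<Rightarrow> real ^ 'm \<Rightarrow> real ^ 'n) \<Rightarrow> (real ^ 'm \<Rightarrow> real ^ 'q) \<Rightarrow> nat \<Rightarrow> real ^ 'm
      \<Rightarrow> (real ^ 'n) \<times> (real ^ 'q)" where
  "block_path p F H i u = (if i = Suc p then (0, H u) else (F i u, 0))"

lemma linear_constraint_map: "linear (constraint_map A B)"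
  unfolding constraint_map_def
  by (intro linearI) (simp_all add: matrix_vector_right_distrib matrix_vector_mult_scaleR
      scaleR_add_right algebra_simps)

lemma linear_block_proj: "linear (block_proj blk p i)"
  unfolding block_proj_def block_part_def
  by (intro linearI) (auto simp: vec_eq_iff)

lemma block_part_id: "v \<in> block_space blk i \<Longrightarrow> block_part blk i v = v"
  by (auto simp: block_space_def block_part_def vec_eq_iff)

lemma block_part_in: "block_part blk i x \<in> block_space blk i"
  by (auto simp: block_space_def block_part_def)

lemma range_block_proj:
  "range (block_proj blk p i) = (if i = Suc p then {0} \<times> UNIV else block_space blk i \<times> {0})"
proof -
  have "(v, 0) \<in> range (block_proj blk p i)" if "v \<in> block_space blk i" "i \<noteq> Suc p" for v
    using that by (intro range_eqI[of _ _ "(v, 0)"]) (simp add: block_proj_def block_part_id)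
  thus ?thesis
    by (auto simp: block_proj_def block_part_in image_iff)
qed

lemma constraint_map_range_block_proj:
  "constraint_map A B ` range (block_proj blk p i) =
     (if i = Suc p then range ((*v) B) else (*v) A ` block_space blk i)"
  unfolding range_block_proj by (auto simp: constraint_map_def image_iff)

lemma norm_block_part: "norm (block_part blk i x) \<le> norm x"
  by (rule norm_le_componentwise_cart) (simp add: block_part_def)

lemma sum_block_part: "(\<Sum>j<m. block_part blk j x) = (\<chi> c. if blk c < m then x $ c else 0)"
  by (simp add: vec_eq_iff block_part_def)

lemma block_glue_eq:
  assumes "block_part blk i x = 0" "v \<in> block_space blk i"
  shows "block_glue blk i x v x = x + v"
proof -
  have "x $ j = 0" if "blk j = i" for j
  proof -
    have "block_part blk i x $ j = 0" using assms(1) by simp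
    thus ?thesis by (simp add: block_part_def that)
  qed
  thus ?thesis using assms(2)
    by (auto simp: vec_eq_iff block_glue_def block_space_def not_less_iff_gr_or_eq)
qed

lemma unique_arg_minD:
  assumes "is_unique_arg_min f Q a" "Q b"
  shows "f a \<le> f b" "f b \<le> f a \<Longrightarrow> b = a"
proof -
  have le: "f a \<le> f c" if "Q c" for c
    using assms(1) that unfolding is_unique_arg_min_def is_arg_min_def by (meson not_le)
  show "f a \<le> f b" using assms(2) by (rule le)
  assume "f b \<le> f a"
  hence "is_arg_min f Q b" using le assms(2) unfolding is_arg_min_def by (meson not_le order_trans)
  thus "b = a" using assms(1) unfolding is_unique_arg_min_def by blast
qed

text \<open>
  The assumptions of the theorem are those of the block problem with \<open>Suc p\<close> as the index of the block
  \<open>y\<close>; the rest is bookkeeping between blocks as sets of coordinates and as projections.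
\<close>

lemma block_problem_of_paths:
  fixes blk :: "'n::finite \<Rightarrow> nat" and A :: "real ^ 'n ^ 'm" and B :: "real ^ 'q ^ 'm"
    and \<phi> :: "(real ^ 'n) \<times> (real ^ 'q) \<Rightarrow> real"
  assumes blocks: "range blk = {..p}"
    and coercive: "coercive_on {(x, y). A *v x + B *v y = 0} \<phi>"
    and feasible: "range ((*v) A) \<subseteq> range ((*v) B)"
    and M_pos: "M > 0"
    and path_y: "lipschitz_path_y \<phi> B M H"
    and path_x: "\<And>i. i \<le> p \<Longrightarrow> lipschitz_path_x \<phi> A blk i M (F i)"
    and grad: "\<And>z. GDERIV \<phi> z :> g z" and lip: "L-lipschitz_on UNIV g"
  shows "block_problem \<phi> g L (constraint_map A B) (block_proj blk p) (Suc p) (block_path p F H) M"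
proof -
  have blk_le: "blk c \<le> p" for c using blocks by blast
  have part_zero: "block_part blk (Suc p) x = 0" for x :: "real ^ 'n"
  proof -
    have "blk c \<noteq> Suc p" for c using blk_le[of c] by simp
    thus ?thesis by (simp add: block_part_def vec_eq_iff)
  qed
  have y_min: "is_unique_arg_min (\<lambda>y. \<phi> (x, y)) (\<lambda>y. B *v y = u) (H u)" if "u \<in> range ((*v) B)" for x u
    using path_y that unfolding lipschitz_path_y_def by blast
  have x_min: "is_unique_arg_min (\<lambda>v. \<phi> (block_glue blk i x v x, y))
      (\<lambda>v. v \<in> block_space blk i \<and> A *v v = u) (F i u)" if "i \<le> p" "u \<in> (*v) A ` block_space blk i" for i x y u
    using path_x[OF that(1)] that(2) unfolding lipschitz_path_x_def by blast
  have x_in: "F i u \<in> block_space blk i \<and> A *v F i u = u" if "i \<le> p" "u \<in> (*v) A ` block_space blk i" for i u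
    using x_min[OF that] unfolding is_unique_arg_min_def is_arg_min_def by blast
  have y_in: "B *v H u = u" if "u \<in> range ((*v) B)" for u
    using y_min[OF that] unfolding is_unique_arg_min_def is_arg_min_def by blast
  have path: "\<phi> (c + block_path p F H i (constraint_map A B v)) \<le> \<phi> (c + v)"
    "\<phi> (c + v) \<le> \<phi> (c + block_path p F H i (constraint_map A B v)) \<Longrightarrow>
       v = block_path p F H i (constraint_map A B v)"
    if i: "i \<le> Suc p" and v: "v \<in> range (block_proj blk p i)" and c: "block_proj blk p i c = 0" for i v c
  proof -
    obtain x y where xy: "c = (x, y)" by fastforce
    have "\<phi> (c + block_path p F H i (constraint_map A B v)) \<le> \<phi> (c + v) \<and>
      (\<phi> (c + v) \<le> \<phi> (c + block_path p F H i (constraint_map A B v)) \<longrightarrow>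
       v = block_path p F H i (constraint_map A B v))"
    proof (cases "i = Suc p")
      case True
      obtain v2 where v2: "v = (0, v2)" using v True by (auto simp: range_block_proj)
      have y: "y = 0" using c True xy by (simp add: block_proj_def zero_prod_def)
      have u: "constraint_map A B v = B *v v2" by (simp add: v2 constraint_map_def)
      show ?thesis
        using unique_arg_minD[OF y_min[of "B *v v2" x], of v2]
        unfolding u by (simp add: True v2 y xy block_path_def)
    next
      case False
      hence ip: "i \<le> p" using i by simp
      obtain v1 where v1: "v = (v1, 0)" "v1 \<in> block_space blk i"
        using v False by (auto simp: range_block_proj)
      have x: "block_part blk i x = 0" using c False xy by (simp add: block_proj_def zero_prod_def)
      have u: "constraint_map A B v = A *v v1" by (simp add: v1 constraint_map_def)
      have u_in: "A *v v1 \<in> (*v) A ` block_space blk i" using v1 by blast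
      show ?thesis
        using unique_arg_minD[OF x_min[OF ip u_in, of x y], of v1] x_in[OF ip u_in] v1(2)
        unfolding u by (simp add: False v1(1) xy block_path_def block_glue_eq[OF x])
    qed
    thus "\<phi> (c + block_path p F H i (constraint_map A B v)) \<le> \<phi> (c + v)"
      "\<phi> (c + v) \<le> \<phi> (c + block_path p F H i (constraint_map A B v)) \<Longrightarrow>
       v = block_path p F H i (constraint_map A B v)" by blast+
  qed
  let ?P = "block_proj blk p :: nat \<Rightarrow> (real ^ 'n) \<times> (real ^ 'q) \<Rightarrow> (real ^ 'n) \<times> (real ^ 'q)"
  show ?thesis
  proof (rule block_problem.intro)
    show "linear (constraint_map A B)" by (rule linear_constraint_map)
    show "linear (?P i)" for i by (rule linear_block_proj)
    show "?P i (?P j z) = (if i = j then ?P i z else 0)" for i j z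
      by (auto simp: block_proj_def block_part_def vec_eq_iff zero_prod_def)
    show "(\<Sum>i\<le>Suc p. ?P i z) = z" for z :: "(real ^ 'n) \<times> (real ^ 'q)"
    proof -
      have "(\<Sum>i\<le>p. ?P i z) = ((\<Sum>i<Suc p. block_part blk i (fst z)), 0)"
        by (simp add: block_proj_def prod_eq_iff fst_sum snd_sum lessThan_Suc_atMost del: sum.lessThan_Suc)
      also have "(\<Sum>i<Suc p. block_part blk i (fst z)) = fst z"
        unfolding sum_block_part using blk_le by (simp add: vec_eq_iff less_Suc_eq_le)
      finally show ?thesis by (simp add: block_proj_def)
    qed
    show "norm (?P i z) \<le> norm z" for i and z :: "(real ^ 'n) \<times> (real ^ 'q)"
      using norm_fst_le[of "fst z" "snd z"] norm_snd_le[of "snd z" "fst z"] norm_block_part[of blk i "fst z"]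
      by (auto simp: block_proj_def intro: order_trans)
    show "block_path p F H i u \<in> range (?P i) \<and>
        constraint_map A B (block_path p F H i u) = u"
      if "i \<le> Suc p" "u \<in> constraint_map A B ` range (?P i)" for i u
      using that x_in[of i u] y_in[of u]
      unfolding constraint_map_range_block_proj range_block_proj
      by (auto simp: block_path_def constraint_map_def le_Suc_eq split: if_splits)
    show "M-lipschitz_on (constraint_map A B ` range (?P i)) (block_path p F H i)"
      if "i \<le> Suc p" for i
    proof (cases "i = Suc p")
      case True
      have "M-lipschitz_on (range ((*v) B)) H" using path_y unfolding lipschitz_path_y_def by blast
      thus ?thesis unfolding constraint_map_range_block_proj
        by (auto simp: True block_path_def lipschitz_on_def dist_Pair_Pair)
    next
      case False
      hence "M-lipschitz_on ((*v) A ` block_space blk i) (F i)"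
        using path_x[of i] that unfolding lipschitz_path_x_def by simp
      thus ?thesis unfolding constraint_map_range_block_proj
        by (auto simp: False block_path_def lipschitz_on_def dist_Pair_Pair)
    qed
    show "range (constraint_map A B) \<subseteq> constraint_map A B ` range (?P (Suc p))"
    proof
      fix u assume "u \<in> range (constraint_map A B)"
      then obtain x y where u: "u = A *v x + B *v y" by (auto simp: constraint_map_def)
      obtain y' where "A *v x = B *v y'" using feasible by blast
      hence "u = B *v (y' + y)" by (simp add: u matrix_vector_right_distrib)
      thus "u \<in> constraint_map A B ` range (?P (Suc p))"
        unfolding constraint_map_range_block_proj by simp
    qed
    show "coercive_on {z. constraint_map A B z = 0} \<phi>"
      using coercive by (simp add: constraint_map_def case_prod_unfold)
  qed (use path grad lip M_pos in auto)
qed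

text \<open>
  The descent estimates start at iterate 1, so limit points are taken to the shifted sequence.  The
  subsequence drops its first index, which may be 0.
\<close>

lemma seq_limit_point_Suc:
  assumes "seq_limit_point Z l"
  shows "seq_limit_point (\<lambda>k. Z (Suc k)) l"
proof -
  obtain r where r: "strict_mono r" and lim: "(Z \<circ> r) \<longlonglongrightarrow> l"
    using assms unfolding seq_limit_point_def by blast
  define s where "s n = r (Suc n) - 1" for n
  have r_pos: "Suc (s n) = r (Suc n)" for n
    using strict_mono_imp_increasing[OF r, of "Suc n"] by (simp add: s_def)
  have "strict_mono s"
  proof (rule strict_monoI_Suc)
    fix n
    have "r (Suc n) < r (Suc (Suc n))" using r by (simp add: strict_mono_Suc_iff)
    thus "s n < s (Suc n)" unfolding r_pos[symmetric] by simp
  qed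
  moreover have "((\<lambda>k. Z (Suc k)) \<circ> s) \<longlonglongrightarrow> l"
    using LIMSEQ_Suc[OF lim] by (simp add: o_def r_pos)
  ultimately show ?thesis unfolding seq_limit_point_def by blast
qed

section \<open>Convergence of ADMM\<close>

theorem theorem2:
  fixes p :: nat
    and blk :: "'n::finite \<Rightarrow> nat"
    and A :: "real ^ 'n ^ 'm"
    and B :: "real ^ 'q ^ 'm"
    and \<phi> :: "(real ^ 'n) \<times> (real ^ 'q) \<Rightarrow> real"
    and H :: "real ^ 'm \<Rightarrow> real ^ 'q"
    and F :: "nat \<Rightarrow> real ^ 'm \<Rightarrow> real ^ 'n"
    and M L\<phi> :: real
  assumes blocks: "range blk = {..p}"
    and coercive: "coercive_on {(x, y). A *v x + B *v y = 0} \<phi>"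
    and feasible: "range ((*v) A) \<subseteq> range ((*v) B)"
    and M_pos: "M > 0"
    and path_y: "lipschitz_path_y \<phi> B M H"
    and path_x: "\<And>i. i \<le> p \<Longrightarrow> lipschitz_path_x \<phi> A blk i M (F i)"
    and smooth: "lipschitz_differentiable L\<phi> \<phi>"
  shows "\<exists>\<beta>\<^sub>0>0. \<forall>\<beta>\<ge>\<beta>\<^sub>0.
    (\<forall>x\<^sub>0 y\<^sub>0 w\<^sub>0. \<exists>X Y W. X 0 = x\<^sub>0 \<and> Y 0 = y\<^sub>0 \<and> W 0 = w\<^sub>0 \<and> is_ADMM_sequence \<phi> A B blk p \<beta> X Y W) \<and>
    (\<forall>X Y W. is_ADMM_sequence \<phi> A B blk p \<beta> X Y W \<longrightarrow>
      bounded (range (\<lambda>k. (X k, Y k, W k))) \<and>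
      (\<exists>z. seq_limit_point (\<lambda>k. (X k, Y k, W k)) z) \<and>
      (\<forall>z. seq_limit_point (\<lambda>k. (X k, Y k, W k)) z \<longrightarrow>
           0 \<in> limiting_subdiff (\<lambda>z. ereal (aug_lagrangian \<phi> A B \<beta> z)) z) \<and>
      (KL_function (\<lambda>z. ereal (aug_lagrangian \<phi> A B \<beta> z)) \<longrightarrow>
        (\<exists>z. (\<lambda>k. (X k, Y k, W k)) \<longlonglongrightarrow> z \<and>
             (\<forall>z'. seq_limit_point (\<lambda>k. (X k, Y k, W k)) z' \<longrightarrow> z' = z))))"
proof -
  obtain g where grad: "\<And>z. GDERIV \<phi> z :> g z" and lip: "L\<phi>-lipschitz_on UNIV g"
    using smooth unfolding lipschitz_differentiable_def by blast
  let ?T = "constraint_map A B" and ?P = "block_proj blk p :: nat \<Rightarrow> (real ^ 'n) \<times> (real ^ 'q) \<Rightarrow> _"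
  interpret bp: block_problem \<phi> g L\<phi> ?T ?P "Suc p" "block_path p F H" M
    using blocks coercive feasible M_pos path_y path_x grad lip by (rule block_problem_of_paths)
  have aug: "aug_lagrangian \<phi> A B \<beta> (x, y, w) = bp.lag \<beta> (x, y) w" for \<beta> x y w
    by (simp add: aug_lagrangian_def bp.lag_def constraint_map_def)
  \<comment> \<open>The point at which block \<open>i\<close> is tested is the mixed point, up to a perturbation in block \<open>i\<close>.\<close>
  have glue: "(block_glue blk i a v b, y) =
      bp.mix (Suc i) (a, y') (b, y) + (v - block_part blk i a, 0)"
    if i: "i \<le> p" and v: "v \<in> block_space blk i" for i a b v y y'
  proof -
    have "(\<Sum>j<Suc i. ?P j ((a, y') - (b, y))) = ((\<Sum>j<Suc i. block_part blk j (a - b)), 0)"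
      using i by (simp add: prod_eq_iff fst_sum snd_sum block_proj_def)
    hence "bp.mix (Suc i) (a, y') (b, y) = (b + (\<chi> c. if blk c < Suc i then (a - b) $ c else 0), y)"
      unfolding bp.mix_def sum_block_part by simp
    thus ?thesis using v
      by (auto simp: vec_eq_iff block_glue_def block_part_def block_space_def not_less less_Suc_eq)
  qed
  \<comment> \<open>The two descriptions of the iteration agree, so existence transfers one way and convergence the other.\<close>
  have admm_iff: "is_ADMM_sequence \<phi> A B blk p \<beta> X Y W \<longleftrightarrow> bp.admm_sequence \<beta> (\<lambda>k. (X k, Y k)) W"
    for \<beta> X Y W
  proof -
    have x: "is_arg_min (\<lambda>v. aug_lagrangian \<phi> A B \<beta> (block_glue blk i a v b, y, w))
          (\<lambda>v. v \<in> block_space blk i) (block_part blk i a) \<longleftrightarrow>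
        (\<forall>v\<in>range (?P i). bp.lag \<beta> (bp.mix (Suc i) (a, y') (b, y)) w
          \<le> bp.lag \<beta> (bp.mix (Suc i) (a, y') (b, y) + v) w)"
      if i: "i \<le> p" for i a b y y' w
    proof -
      let ?c = "bp.mix (Suc i) (a, y') (b, y)"
      have "is_arg_min (\<lambda>v. aug_lagrangian \<phi> A B \<beta> (block_glue blk i a v b, y, w))
          (\<lambda>v. v \<in> block_space blk i) (block_part blk i a) \<longleftrightarrow>
        (\<forall>v\<in>block_space blk i. bp.lag \<beta> ?c w \<le> bp.lag \<beta> (?c + (v - block_part blk i a, 0)) w)"
        unfolding is_arg_min_def aug
        using glue[OF i, of _ a b y y'] glue[OF i block_part_in, of a a b y y'] block_part_in[of blk i a]
        by (auto simp: zero_prod_def[symmetric] not_less)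
      also have "\<dots> \<longleftrightarrow> (\<forall>v\<in>block_space blk i. bp.lag \<beta> ?c w \<le> bp.lag \<beta> (?c + (v, 0)) w)"
      proof -
        have "v - block_part blk i a \<in> block_space blk i" "v + block_part blk i a \<in> block_space blk i"
          if "v \<in> block_space blk i" for v
          using that block_part_in[of blk i a] by (auto simp: block_space_def)
        thus ?thesis by (metis add_diff_cancel_right')
      qed
      also have "\<dots> \<longleftrightarrow> (\<forall>v\<in>range (?P i). bp.lag \<beta> ?c w \<le> bp.lag \<beta> (?c + v) w)"
        using i by (auto simp: range_block_proj)
      finally show ?thesis .
    qed
    have y: "is_arg_min (\<lambda>y. aug_lagrangian \<phi> A B \<beta> (a, y, w)) (\<lambda>y. True) y' \<longleftrightarrow>
        (\<forall>v\<in>range (?P (Suc p)). bp.lag \<beta> (bp.mix (Suc (Suc p)) (a, y') b) w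
          \<le> bp.lag \<beta> (bp.mix (Suc (Suc p)) (a, y') b + v) w)" for a y' w b
    proof -
      have "is_arg_min (\<lambda>y. aug_lagrangian \<phi> A B \<beta> (a, y, w)) (\<lambda>y. True) y' \<longleftrightarrow>
          (\<forall>y. bp.lag \<beta> (a, y') w \<le> bp.lag \<beta> (a, y) w)"
        by (simp add: is_arg_min_def aug not_less)
      also have "\<dots> \<longleftrightarrow> (\<forall>y. bp.lag \<beta> (a, y') w \<le> bp.lag \<beta> (a, y' + y) w)"
        by (metis add.commute diff_add_cancel)
      finally show ?thesis by (simp add: bp.mix_full range_block_proj)
    qed
    have all_le: "(\<forall>i\<le>Suc p. Q i) \<longleftrightarrow> (\<forall>i\<le>p. Q i) \<and> Q (Suc p)" for Q
      by (auto simp: le_Suc_eq)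
    have step: "bp.admm_step \<beta> (W k) (X k, Y k) (X (Suc k), Y (Suc k)) \<longleftrightarrow>
        (\<forall>i\<le>p. is_arg_min
          (\<lambda>v. aug_lagrangian \<phi> A B \<beta> (block_glue blk i (X (Suc k)) v (X k), Y k, W k))
          (\<lambda>v. v \<in> block_space blk i) (block_part blk i (X (Suc k)))) \<and>
        is_arg_min (\<lambda>y. aug_lagrangian \<phi> A B \<beta> (X (Suc k), y, W k)) (\<lambda>y. True) (Y (Suc k))" for k
      unfolding bp.admm_step_def all_le
      by (intro arg_cong2[where f = "(\<and>)"] all_cong1 imp_cong refl x[symmetric] y[symmetric])
    show ?thesis
      unfolding is_ADMM_sequence_def bp.admm_sequence_def step
      by (simp add: constraint_map_def conj_assoc)
  qed
  show ?thesis
  proof (intro exI[of _ bp.\<beta>_min] conjI allI impI)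
    show "0 < bp.\<beta>_min" using bp.\<beta>_min_le(1)[OF order_refl] by linarith
    fix \<beta> assume beta: "bp.\<beta>_min \<le> \<beta>"
    show "\<exists>X Y W. X 0 = x\<^sub>0 \<and> Y 0 = y\<^sub>0 \<and> W 0 = w\<^sub>0 \<and> is_ADMM_sequence \<phi> A B blk p \<beta> X Y W"
      for x\<^sub>0 y\<^sub>0 w\<^sub>0
    proof -
      obtain z w where "z 0 = (x\<^sub>0, y\<^sub>0)" "w 0 = w\<^sub>0" "bp.admm_sequence \<beta> z w"
        using bp.admm_sequence_exists[OF beta] by blast
      thus ?thesis
        by (intro exI[of _ "fst \<circ> z"] exI[of _ "snd \<circ> z"] exI[of _ w]) (simp add: admm_iff)
    qed
    let ?f = "aug_lagrangian \<phi> A B \<beta>"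
    \<comment> \<open>The gradient of the augmented Lagrangian in all three variables.\<close>
    define D where "D t = (let l = bp.lag_grad \<beta> (fst t, fst (snd t)) (snd (snd t))
      in (fst l, snd l, ?T (fst t, fst (snd t))))" for t
    have grad_f: "GDERIV ?f t :> D t" for t
    proof -
      have "((\<lambda>s. bp.lag \<beta> (fst s, fst (snd s)) (snd (snd s))) has_derivative
        (\<lambda>h. bp.lag_grad \<beta> (fst t, fst (snd t)) (snd (snd t)) \<bullet> (fst h, fst (snd h))
          + snd (snd h) \<bullet> ?T (fst t, fst (snd t)))) (at t)"
        by (intro bp.has_derivative_lag) (auto intro!: derivative_eq_intros)
      moreover have "?f = (\<lambda>s. bp.lag \<beta> (fst s, fst (snd s)) (snd (snd s)))"
        by (auto simp: aug)
      ultimately show ?thesis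
        unfolding gderiv_def by (simp add: D_def Let_def inner_prod_def inner_commute add.assoc)
    qed
    have cont_D: "continuous_on UNIV D"
      unfolding D_def Let_def
      by (intro continuous_on_Pair continuous_on_fst continuous_on_snd bp.continuous_on_lag_grad
          linear_continuous_on_compose[OF _ linear_constraint_map] continuous_on_id)
    fix X Y W assume "is_ADMM_sequence \<phi> A B blk p \<beta> X Y W"
    hence seq: "bp.admm_sequence \<beta> (\<lambda>k. (X k, Y k)) W" by (simp add: admm_iff)
    define Z where "Z k = (X k, Y k, W k)" for k
    define dz where "dz k = norm ((X (Suc k), Y (Suc k)) - (X k, Y k))" for k
    define dw where "dw k = norm (W (Suc k) - W k)" for k
    have f_Z: "?f (Z k) = bp.lag \<beta> (X k, Y k) (W k)" for k by (simp add: Z_def aug)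
    have norm_Z: "(norm (Z (Suc k) - Z k))\<^sup>2 = (dz k)\<^sup>2 + (dw k)\<^sup>2" for k
      by (simp add: Z_def dz_def dw_def norm_Pair)
    \<comment> \<open>\<open>multiplier_step\<close> bounds the full squared step by \<open>1 / c\<close> times that of the primal variables.\<close>
    define c where "c = 1 / (1 + (L\<phi> * M)\<^sup>2)"
    have c: "0 < c" by (simp add: c_def add_pos_nonneg)
    have decrease: "?f (Z (Suc (Suc k))) + c * (norm (Z (Suc (Suc k)) - Z (Suc k)))\<^sup>2 \<le> ?f (Z (Suc k))" for k
    proof -
      have "(dw (Suc k))\<^sup>2 \<le> (L\<phi> * M * dz (Suc k))\<^sup>2"
        using bp.multiplier_step[OF seq, of k] by (intro power_mono) (auto simp: dz_def dw_def)
      hence "(norm (Z (Suc (Suc k)) - Z (Suc k)))\<^sup>2 \<le> (1 + (L\<phi> * M)\<^sup>2) * (dz (Suc k))\<^sup>2"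
        unfolding norm_Z by (simp add: power_mult_distrib distrib_right)
      hence "c * (norm (Z (Suc (Suc k)) - Z (Suc k)))\<^sup>2 \<le> c * ((1 + (L\<phi> * M)\<^sup>2) * (dz (Suc k))\<^sup>2)"
        using c by (intro mult_left_mono) auto
      also have "\<dots> = (dz (Suc k))\<^sup>2"
        using c unfolding c_def by (simp add: zero_less_divide_iff)
      finally show ?thesis
        using bp.sequence_decrease[OF beta seq, of k] unfolding f_Z dz_def by linarith
    qed
    obtain C where C_pos: "0 < C" and C_bound: "\<forall>z w k. bp.admm_sequence \<beta> z w \<longrightarrow>
        norm (bp.lag_grad \<beta> (z (Suc k)) (w (Suc k))) \<le> C * (norm (z (Suc k) - z k) + norm (w (Suc k) - w k))"
      using bp.lag_grad_bound[OF beta] by blast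
    have C: "norm (bp.lag_grad \<beta> (X (Suc k), Y (Suc k)) (W (Suc k))) \<le> C * (dz k + dw k)" for k
      using C_bound[rule_format, OF seq, of k] by (simp only: dz_def dw_def)
    have slope: "norm (D (Z (Suc k))) \<le> (2 * C + 1) * norm (Z (Suc k) - Z k)" for k
    proof -
      have le: "dz k \<le> norm (Z (Suc k) - Z k)" "dw k \<le> norm (Z (Suc k) - Z k)"
        using norm_Z[of k] by (auto intro!: power2_le_imp_le[OF _ norm_ge_zero])
      let ?l = "bp.lag_grad \<beta> (X (Suc k), Y (Suc k)) (W (Suc k))"
        and ?r = "?T (X (Suc k), Y (Suc k))"
      have beta1: "1 \<le> \<beta>" by (rule bp.\<beta>_min_le(1)[OF beta])
      have "1 * norm ?r \<le> \<beta> * norm ?r" using beta1 by (intro mult_right_mono) auto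
      hence r: "norm ?r \<le> dw k" using bp.seq_w[OF seq, of k] beta1 by (simp add: dw_def)
      have "norm (D (Z (Suc k))) = sqrt ((norm ?l)\<^sup>2 + (norm ?r)\<^sup>2)"
        by (simp add: D_def Z_def Let_def norm_Pair norm_prod_def add.assoc)
      also have "\<dots> \<le> norm ?l + norm ?r" by (intro sqrt_sum_squares_le_sum) auto
      also have "\<dots> \<le> C * (dz k + dw k) + dw k" using C[of k] r by linarith
      also have "\<dots> \<le> C * (norm (Z (Suc k) - Z k) + norm (Z (Suc k) - Z k)) + norm (Z (Suc k) - Z k)"
        using le C_pos by (intro add_mono mult_left_mono) auto
      finally show ?thesis by (simp add: algebra_simps)
    qed
    have bounded: "bounded (range Z)"
    proof -
      have "bounded (range X)" "bounded (range Y)"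
        using bounded_fst[OF bp.sequence_bounded(1)[OF beta seq]] bounded_snd[OF bp.sequence_bounded(1)[OF beta seq]]
        by (simp_all add: image_image)
      hence "bounded (range X \<times> range Y \<times> range W)"
        by (intro bounded_Times bp.sequence_bounded(2)[OF beta seq])
      thus ?thesis by (rule bounded_subset) (auto simp: Z_def)
    qed
    thus "bounded (range (\<lambda>k. (X k, Y k, W k)))" by (simp add: Z_def[abs_def])
    obtain l r where "strict_mono r" "(Z \<circ> r) \<longlonglongrightarrow> l"
      using bounded_imp_convergent_subsequence[OF bounded] by blast
    hence l: "seq_limit_point Z l" unfolding seq_limit_point_def by blast
    thus "\<exists>z. seq_limit_point (\<lambda>k. (X k, Y k, W k)) z" unfolding Z_def[abs_def] by blast
    show "0 \<in> limiting_subdiff (\<lambda>z. ereal (?f z)) z"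
      if "seq_limit_point (\<lambda>k. (X k, Y k, W k)) z" for z
    proof -
      have "seq_limit_point (\<lambda>k. Z (Suc k)) z"
        using that unfolding Z_def by (rule seq_limit_point_Suc)
      hence "D z = 0"
        by (rule descent_limit_point_critical[where Z = "\<lambda>k. Z (Suc k)", OF grad_f cont_D c decrease slope])
      thus ?thesis using gradient_in_limiting_subdiff[OF grad_f, of z] by simp
    qed
    show "\<exists>z. (\<lambda>k. (X k, Y k, W k)) \<longlonglongrightarrow> z \<and>
        (\<forall>z'. seq_limit_point (\<lambda>k. (X k, Y k, W k)) z' \<longrightarrow> z' = z)"
      if KL: "KL_function (\<lambda>z. ereal (?f z))"
    proof -
      have "0 < 2 * C + 1" using C_pos by simp
      hence "(\<lambda>k. Z (Suc k)) \<longlonglongrightarrow> l"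
        by (rule KL_convergence[where Z = "\<lambda>k. Z (Suc k)", OF grad_f KL c decrease _ slope seq_limit_point_Suc[OF l]])
      hence lim: "Z \<longlonglongrightarrow> l" by (rule LIMSEQ_imp_Suc)
      have "z' = l" if "seq_limit_point Z z'" for z'
        using that LIMSEQ_unique[OF _ LIMSEQ_subseq_LIMSEQ[OF lim]] unfolding seq_limit_point_def by blast
      thus ?thesis using lim unfolding Z_def[abs_def] by blast
    qed
  qed
qed

end
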